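(* Let $(M,g)$ be a stationary Lorentzian manifold with timelike Killing vector field $\mathcal Y$, and let $\gamma$ be a closed geodesic in $M$. Then there exists a bounded sequence of integers $(d_N)_{N\ge1}$ such that the sequence $N\mapsto\mu\big(\gamma^{(N)}\big)+d_N\in\mathbb Z$ is nondecreasing.
   Context: A Lorentzian manifold has metric of index $1$; it is stationary if it carries a timelike Killing field $\mathcal Y$. A closed geodesic is a geodesic $\gamma:[0,1]\to M$ with $\gamma(0)=\gamma(1)$, $\dot\gamma(0)=\dot\gamma(1)$; its $N$-th iterate is $\gamma^{(N)}(t)=\widetilde\gamma(Nt)$, $t\in[0,1]$, where $\widetilde\gamma:\mathbb R\to M$ is the periodic extension of $\gamma$. $\Lambda M$ is the Hilbert manifold of $H^1$ loops $\gamma:[0,1]\to M$, $\gamma(0)=\gamma(1)$; $f(\gamma)=\frac12\int_0^1 g(\dot\gamma,\dot\gamma)\,dt$; $\mathcal N=\{\gamma\in\Lambda M: g(\dot\gamma,\mathcal Y)\ \text{is constant a.e.}\}$, a smooth submanifold of $\Lambda M$ whose tangent space $T_\gamma\mathcal N$ consists of the periodic ($V(0)=V(1)$) $H^1$ vector fields $V$ along $\gamma$ such that $g(\frac{\mathrm D}{\mathrm dt}V,\mathcal Y)-g(V,\frac{\mathrm D}{\mathrm dt}\mathcal Y)$ is constant a.e. For a closed geodesic $\gamma$ (equivalently, a critical point of $f|_{\mathcal N}$) the index form is $I_\gamma(V,W)=\int_0^1 g(\frac{\mathrm D}{\mathrm dt}V,\frac{\mathrm D}{\mathrm dt}W)+g(R(\dot\gamma,V)\dot\gamma,W)\,dt$,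 where $R(X,Y)=\nabla_X\nabla_Y-\nabla_Y\nabla_X-\nabla_{[X,Y]}$. The Morse index $\mu(\gamma)$ is the (finite) maximal dimension of a subspace of $T_\gamma\mathcal N$ on which $I_\gamma$ is negative definite. *)

theory Defs
  imports "HOL-Analysis.Analysis" "HOL-Library.Function_Algebras"
begin

instantiation "fun" :: (type, real_vector) real_vector
begin

definition scaleR_fun :: "real \<Rightarrow> ('a \<Rightarrow> 'b) \<Rightarrow> 'a \<Rightarrow> 'b"
  where "scaleR_fun r f = (\<lambda>x. r *\<^sub>R f x)"

instance
  by standard (simp_all add: scaleR_fun_def fun_eq_iff scaleR_add_right scaleR_add_left)

end

text \<open>
  The maximal dimension of a subspace of \<open>T\<close> on which \<open>b\<close> is negative definite.
  It is meaningful when these dimensions are bounded: \<^const>\<open>Sup\<close> on the naturals is then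
  a maximum, the zero subspace being always admissible.
\<close>

definition neg_index :: "'v::real_vector set \<Rightarrow> ('v \<Rightarrow> 'v \<Rightarrow> real) \<Rightarrow> nat" where
  "neg_index T b = Sup {dim S | S. subspace S \<and> S \<subseteq> T \<and> (\<forall>v\<in>S. v \<noteq> 0 \<longrightarrow> b v v < 0)}"


subsection \<open>Smooth manifolds\<close>

text \<open>For open \<open>S\<close>; the domain is finite-dimensional in all uses.\<close>

primrec Ck_on :: "nat \<Rightarrow> 'a::real_normed_vector set \<Rightarrow> ('a \<Rightarrow> 'b::real_normed_vector) \<Rightarrow> bool" where
  "Ck_on 0 S f = continuous_on S f"
| "Ck_on (Suc k) S f =
     ((\<forall>x\<in>S. f differentiable (at x)) \<and> (\<forall>v. Ck_on k S (\<lambda>x. frechet_derivative f (at x) v)))"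

definition smooth_on :: "'a::real_normed_vector set \<Rightarrow> ('a \<Rightarrow> 'b::real_normed_vector) \<Rightarrow> bool" where
  "smooth_on S f \<longleftrightarrow> (\<forall>k. Ck_on k S f)"

type_synonym ('p, 'e) chart = "'p set \<times> ('p \<Rightarrow> 'e)"

abbreviation cdom :: "('p, 'e) chart \<Rightarrow> 'p set" where "cdom \<equiv> fst"
abbreviation cmap :: "('p, 'e) chart \<Rightarrow> 'p \<Rightarrow> 'e" where "cmap \<equiv> snd"
abbreviation cinv :: "('p, 'e) chart \<Rightarrow> 'e \<Rightarrow> 'p" where "cinv c \<equiv> inv_into (cdom c) (cmap c)"
abbreviation cimage :: "('p, 'e) chart \<Rightarrow> 'e set" where "cimage c \<equiv> cmap c ` cdom c"

definition is_chart :: "('p::topological_space, 'e::euclidean_space) chart \<Rightarrow> bool" where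
  "is_chart c \<longleftrightarrow> open (cdom c) \<and> open (cimage c) \<and>
     homeomorphism (cdom c) (cimage c) (cmap c) (cinv c)"

definition smooth_atlas ::
  "('p::{t2_space, second_countable_topology}, 'e::euclidean_space) chart set \<Rightarrow> bool" where
  "smooth_atlas A \<longleftrightarrow>
     (\<forall>c\<in>A. is_chart c) \<and> (\<Union>c\<in>A. cdom c) = UNIV \<and>
     (\<forall>c\<in>A. \<forall>d\<in>A. smooth_on (cmap c ` (cdom c \<inter> cdom d)) (cmap d \<circ> cinv c))"

text \<open>
  A tangent vector at \<open>p\<close> is the family of its coordinate vectors in the charts around \<open>p\<close>,
  related by the differentials of the coordinate changes. The value 0 at all other charts is a
  normalization that makes the tangent space a vector space of functions.
\<close>

type_synonym ('p, 'e) tvec = "('p, 'e) chart \<Rightarrow> 'e"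

definition tangent_space ::
  "('p, 'e::euclidean_space) chart set \<Rightarrow> 'p \<Rightarrow> ('p, 'e) tvec set" where
  "tangent_space A p = {v.
     (\<forall>c\<in>A. \<forall>d\<in>A. p \<in> cdom c \<and> p \<in> cdom d \<longrightarrow>
        v d = frechet_derivative (cmap d \<circ> cinv c) (at (cmap c p)) (v c)) \<and>
     (\<forall>c. c \<notin> A \<or> p \<notin> cdom c \<longrightarrow> v c = 0)}"

text \<open>The tangent vector at \<open>p\<close> with coordinate vector \<open>u\<close> in the chart \<open>c\<close>.\<close>

definition coord_vec ::
  "('p, 'e::euclidean_space) chart set \<Rightarrow> ('p, 'e) chart \<Rightarrow> 'p \<Rightarrow> 'e \<Rightarrow> ('p, 'e) tvec" where
  "coord_vec A c p u = (\<lambda>d. if d \<in> A \<and> p \<in> cdom d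
     then frechet_derivative (cmap d \<circ> cinv c) (at (cmap c p)) u else 0)"

definition smooth_vector_field ::
  "('p, 'e::euclidean_space) chart set \<Rightarrow> ('p \<Rightarrow> ('p, 'e) tvec) \<Rightarrow> bool" where
  "smooth_vector_field A X \<longleftrightarrow>
     (\<forall>p. X p \<in> tangent_space A p) \<and> (\<forall>c\<in>A. smooth_on (cimage c) (\<lambda>x. X (cinv c x) c))"


subsection \<open>Lorentzian metrics, Levi-Civita connection, curvature\<close>

type_synonym ('p, 'e) metric = "'p \<Rightarrow> ('p, 'e) tvec \<Rightarrow> ('p, 'e) tvec \<Rightarrow> real"

definition metric_coord :: "('p, 'e::euclidean_space) chart set \<Rightarrow> ('p, 'e) metric \<Rightarrow>
    ('p, 'e) chart \<Rightarrow> 'e \<Rightarrow> 'e \<Rightarrow> 'e \<Rightarrow> real" where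
  "metric_coord A g c x u v =
     g (cinv c x) (coord_vec A c (cinv c x) u) (coord_vec A c (cinv c x) v)"

definition sym_bilinear_on :: "'v::real_vector set \<Rightarrow> ('v \<Rightarrow> 'v \<Rightarrow> real) \<Rightarrow> bool" where
  "sym_bilinear_on T b \<longleftrightarrow>
     (\<forall>u\<in>T. \<forall>v\<in>T. b u v = b v u) \<and>
     (\<forall>u\<in>T. \<forall>v\<in>T. \<forall>w\<in>T. b (u + v) w = b u w + b v w) \<and>
     (\<forall>r. \<forall>u\<in>T. \<forall>v\<in>T. b (r *\<^sub>R u) v = r * b u v)"

definition nondegenerate_on :: "'v::real_vector set \<Rightarrow> ('v \<Rightarrow> 'v \<Rightarrow> real) \<Rightarrow> bool" where
  "nondegenerate_on T b \<longleftrightarrow> (\<forall>u\<in>T. (\<forall>v\<in>T. b u v = 0) \<longrightarrow> u = 0)"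

definition lorentzian_metric ::
  "('p, 'e::euclidean_space) chart set \<Rightarrow> ('p, 'e) metric \<Rightarrow> bool" where
  "lorentzian_metric A g \<longleftrightarrow>
     (\<forall>p. sym_bilinear_on (tangent_space A p) (g p) \<and>
          nondegenerate_on (tangent_space A p) (g p) \<and>
          neg_index (tangent_space A p) (g p) = 1) \<and>
     (\<forall>c\<in>A. \<forall>u v. smooth_on (cimage c) (\<lambda>x. metric_coord A g c x u v))"

text \<open>
  The Koszul formula for coordinate vector fields: \<open>christoffel A g c x u v\<close> is
  \<open>\<nabla>\<^sub>u v\<close> at \<open>x\<close>, with \<open>u\<close>, \<open>v\<close> extended to fields that are constant in the chart \<open>c\<close>.
\<close>

definition christoffel :: "('p, 'e::euclidean_space) chart set \<Rightarrow> ('p, 'e) metric \<Rightarrow>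
    ('p, 'e) chart \<Rightarrow> 'e \<Rightarrow> 'e \<Rightarrow> 'e \<Rightarrow> 'e" where
  "christoffel A g c x u v = (THE z. \<forall>w.
     2 * metric_coord A g c x z w =
       frechet_derivative (\<lambda>y. metric_coord A g c y v w) (at x) u
     + frechet_derivative (\<lambda>y. metric_coord A g c y u w) (at x) v
     - frechet_derivative (\<lambda>y. metric_coord A g c y u v) (at x) w)"

text \<open>In the next three definitions \<open>X\<close>, \<open>Y\<close>, \<open>Z\<close> are vector fields in the coordinates of \<open>c\<close>.\<close>

definition nabla :: "('p, 'e::euclidean_space) chart set \<Rightarrow> ('p, 'e) metric \<Rightarrow>
    ('p, 'e) chart \<Rightarrow> ('e \<Rightarrow> 'e) \<Rightarrow> ('e \<Rightarrow> 'e) \<Rightarrow> 'e \<Rightarrow> 'e" where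
  "nabla A g c X Y = (\<lambda>x. frechet_derivative Y (at x) (X x) + christoffel A g c x (X x) (Y x))"

definition lie_bracket :: "('e::euclidean_space \<Rightarrow> 'e) \<Rightarrow> ('e \<Rightarrow> 'e) \<Rightarrow> 'e \<Rightarrow> 'e" where
  "lie_bracket X Y =
     (\<lambda>x. frechet_derivative Y (at x) (X x) - frechet_derivative X (at x) (Y x))"

definition curvature_coord :: "('p, 'e::euclidean_space) chart set \<Rightarrow> ('p, 'e) metric \<Rightarrow>
    ('p, 'e) chart \<Rightarrow> ('e \<Rightarrow> 'e) \<Rightarrow> ('e \<Rightarrow> 'e) \<Rightarrow> ('e \<Rightarrow> 'e) \<Rightarrow> 'e \<Rightarrow> 'e" where
  "curvature_coord A g c X Y Z = (\<lambda>x.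
     nabla A g c X (nabla A g c Y Z) x - nabla A g c Y (nabla A g c X Z) x
     - nabla A g c (lie_bracket X Y) Z x)"

text \<open>
  The curvature is tensorial, so its value on tangent vectors may be computed from their
  extensions to fields that are constant in the chart.
\<close>

definition curvature :: "('p, 'e::euclidean_space) chart set \<Rightarrow> ('p, 'e) metric \<Rightarrow> 'p \<Rightarrow>
    ('p, 'e) tvec \<Rightarrow> ('p, 'e) tvec \<Rightarrow> ('p, 'e) tvec \<Rightarrow> ('p, 'e) tvec" where
  "curvature A g p u v w = (\<lambda>c. if c \<in> A \<and> p \<in> cdom c
     then curvature_coord A g c (\<lambda>_. u c) (\<lambda>_. v c) (\<lambda>_. w c) (cmap c p) else 0)"

text \<open>
  \<open>L\<^sub>Y g (X, Z) = Y (g (X, Z)) - g ([Y, X], Z) - g (X, [Y, Z])\<close> is tensorial in \<open>X\<close> and \<open>Z\<close>,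
  so it suffices to let these be constant in the chart.
\<close>

definition killing_field :: "('p, 'e::euclidean_space) chart set \<Rightarrow> ('p, 'e) metric \<Rightarrow>
    ('p \<Rightarrow> ('p, 'e) tvec) \<Rightarrow> bool" where
  "killing_field A g Y \<longleftrightarrow> smooth_vector_field A Y \<and>
     (\<forall>c\<in>A. \<forall>x\<in>cimage c. \<forall>u v.
        frechet_derivative (\<lambda>y. metric_coord A g c y u v) (at x) (Y (cinv c x) c)
        - metric_coord A g c x (lie_bracket (\<lambda>y. Y (cinv c y) c) (\<lambda>_. u) x) v
        - metric_coord A g c x u (lie_bracket (\<lambda>y. Y (cinv c y) c) (\<lambda>_. v) x) = 0)"

definition timelike_field ::
  "('p, 'e) metric \<Rightarrow> ('p \<Rightarrow> ('p, 'e) tvec) \<Rightarrow> bool" where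
  "timelike_field g Y \<longleftrightarrow> (\<forall>p. g p (Y p) (Y p) < 0)"


subsection \<open>Closed geodesics and their iterates\<close>

text \<open>
  Curves are parametrized by \<open>{0..1}\<close>; their values elsewhere are irrelevant, and
  derivatives at the end points are one-sided.
\<close>

definition velocity :: "('p, 'e::euclidean_space) chart set \<Rightarrow> (real \<Rightarrow> 'p) \<Rightarrow>
    real \<Rightarrow> ('p, 'e) tvec" where
  "velocity A \<gamma> t = (\<lambda>c. if c \<in> A \<and> \<gamma> t \<in> cdom c
     then vector_derivative (\<lambda>s. cmap c (\<gamma> s)) (at t within {0..1}) else 0)"

text \<open>Covariant derivative along \<open>\<gamma>\<close>, meaningful where \<open>V\<close> is differentiable.\<close>

definition cov_deriv :: "('p, 'e::euclidean_space) chart set \<Rightarrow> ('p, 'e) metric \<Rightarrow>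
    (real \<Rightarrow> 'p) \<Rightarrow> (real \<Rightarrow> ('p, 'e) tvec) \<Rightarrow> real \<Rightarrow> ('p, 'e) tvec" where
  "cov_deriv A g \<gamma> V t = (\<lambda>c. if c \<in> A \<and> \<gamma> t \<in> cdom c
     then vector_derivative (\<lambda>s. V s c) (at t within {0..1})
          + christoffel A g c (cmap c (\<gamma> t)) (velocity A \<gamma> t c) (V t c)
     else 0)"

definition geodesic :: "('p::topological_space, 'e::euclidean_space) chart set \<Rightarrow>
    ('p, 'e) metric \<Rightarrow> (real \<Rightarrow> 'p) \<Rightarrow> bool" where
  "geodesic A g \<gamma> \<longleftrightarrow> continuous_on {0..1} \<gamma> \<and>
     (\<forall>t\<in>{0..1}. \<forall>c\<in>A. \<gamma> t \<in> cdom c \<longrightarrow>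
        (\<lambda>s. cmap c (\<gamma> s)) differentiable (at t within {0..1}) \<and>
        (\<lambda>s. velocity A \<gamma> s c) differentiable (at t within {0..1})) \<and>
     (\<forall>t\<in>{0..1}. cov_deriv A g \<gamma> (velocity A \<gamma>) t = 0)"

definition closed_geodesic :: "('p::topological_space, 'e::euclidean_space) chart set \<Rightarrow>
    ('p, 'e) metric \<Rightarrow> (real \<Rightarrow> 'p) \<Rightarrow> bool" where
  "closed_geodesic A g \<gamma> \<longleftrightarrow>
     geodesic A g \<gamma> \<and> \<gamma> 0 = \<gamma> 1 \<and> velocity A \<gamma> 0 = velocity A \<gamma> 1"

text \<open>\<open>\<lambda>t. \<gamma> (frac t)\<close> is the periodic extension of \<open>\<gamma>\<close>.\<close>

definition iterate :: "(real \<Rightarrow> 'p) \<Rightarrow> nat \<Rightarrow> real \<Rightarrow> 'p" where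
  "iterate \<gamma> N = (\<lambda>t. \<gamma> (frac (real N * t)))"


subsection \<open>The index form and the Morse index\<close>

definition H1_on :: "real \<Rightarrow> real \<Rightarrow> (real \<Rightarrow> 'e::euclidean_space) \<Rightarrow> bool" where
  "H1_on a b f \<longleftrightarrow> (\<exists>w. w absolutely_integrable_on {a..b} \<and>
     (\<lambda>t. (norm (w t))\<^sup>2) integrable_on {a..b} \<and>
     (\<forall>t\<in>{a..b}. f t = f a + integral {a..t} w))"

text \<open>The value 0 outside \<open>{0..1}\<close> is a normalization, as for tangent vectors.\<close>

definition H1_field_along :: "('p, 'e::euclidean_space) chart set \<Rightarrow> (real \<Rightarrow> 'p) \<Rightarrow>
    (real \<Rightarrow> ('p, 'e) tvec) \<Rightarrow> bool" where
  "H1_field_along A \<gamma> V \<longleftrightarrow>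
     (\<forall>t\<in>{0..1}. V t \<in> tangent_space A (\<gamma> t)) \<and> (\<forall>t. t \<notin> {0..1} \<longrightarrow> V t = 0) \<and>
     (\<forall>c\<in>A. \<forall>a b. 0 \<le> a \<and> a \<le> b \<and> b \<le> 1 \<and> \<gamma> ` {a..b} \<subseteq> cdom c \<longrightarrow>
        H1_on a b (\<lambda>t. V t c))"

text \<open>The tangent space at \<open>\<gamma>\<close> of the loops \<open>\<sigma>\<close> with \<open>g(\<sigma>', Y)\<close> constant a.e.\<close>

definition tangent_N :: "('p, 'e::euclidean_space) chart set \<Rightarrow> ('p, 'e) metric \<Rightarrow>
    ('p \<Rightarrow> ('p, 'e) tvec) \<Rightarrow> (real \<Rightarrow> 'p) \<Rightarrow> (real \<Rightarrow> ('p, 'e) tvec) set" where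
  "tangent_N A g Y \<gamma> = {V. H1_field_along A \<gamma> V \<and> V 0 = V 1 \<and>
     (\<exists>k. AE t in lebesgue_on {0..1}.
        g (\<gamma> t) (cov_deriv A g \<gamma> V t) (Y (\<gamma> t))
        - g (\<gamma> t) (V t) (cov_deriv A g \<gamma> (\<lambda>s. Y (\<gamma> s)) t) = k)}"

definition index_form :: "('p, 'e::euclidean_space) chart set \<Rightarrow> ('p, 'e) metric \<Rightarrow>
    (real \<Rightarrow> 'p) \<Rightarrow> (real \<Rightarrow> ('p, 'e) tvec) \<Rightarrow> (real \<Rightarrow> ('p, 'e) tvec) \<Rightarrow> real" where
  "index_form A g \<gamma> V W = integral {0..1} (\<lambda>t.
     g (\<gamma> t) (cov_deriv A g \<gamma> V t) (cov_deriv A g \<gamma> W t)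
     + g (\<gamma> t) (curvature A g (\<gamma> t) (velocity A \<gamma> t) (V t) (velocity A \<gamma> t)) (W t))"

definition morse_index :: "('p, 'e::euclidean_space) chart set \<Rightarrow> ('p, 'e) metric \<Rightarrow>
    ('p \<Rightarrow> ('p, 'e) tvec) \<Rightarrow> (real \<Rightarrow> 'p) \<Rightarrow> nat" where
  "morse_index A g Y \<gamma> = neg_index (tangent_N A g Y \<gamma>) (index_form A g \<gamma>)"

end

theory Submission
  imports Defs
begin

text \<open>
  Let \<open>N < M\<close> and let \<open>V\<close> be a field along the \<open>N\<close>-th iterate, defined on \<open>[0, 1]\<close>, with \<open>V(0) = V(1) = 0\<close>
  and with vanishing constant \<open>g(V', Y) - g(V, Y')\<close>. Extended by zero and reparametrized by
  \<open>s \<mapsto> V(M s / N)\<close> it is tangent to the constraint manifold along the \<open>M\<close>-th iterate, and the index form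
  is multiplied by \<open>M / N\<close>. The two conditions cut out a subspace of codimension at most
  \<open>n + 1\<close>, \<open>n\<close> the dimension of the manifold, hence \<open>\<mu>(\<gamma>\<^sup>(\<^sup>N\<^sup>)) \<le> \<mu>(\<gamma>\<^sup>(\<^sup>M\<^sup>)) + n + 1\<close>, and
  \<open>d N = max {\<mu>(\<gamma>\<^sup>(\<^sup>k\<^sup>)) | k \<le> N} - \<mu>(\<gamma>\<^sup>(\<^sup>N\<^sup>))\<close> works.

  The metric is bilinear on tangent vectors only, so the rescaling of the index form uses that
  covariant derivatives and curvature are tangent vectors: the transformation laws of the Christoffel
  symbols and of the curvature under coordinate changes. Derivatives of \<open>H\<^sup>1\<close> fields exist almost
  everywhere by Lebesgue's differentiation theorem.
\<close>

subsection \<open>Linear algebra and bounded corrections\<close>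

text \<open>Both conditions on \<open>V\<close> come from the extension by zero. It is continuous
  only if \<open>V 0 = 0\<close>, and on the tail, where the field vanishes, the constraint is 0, so
  the constant must be 0 there and hence everywhere. As \<open>V 0 = V 1\<close> holds anyway, the
  first condition costs \<open>DIM('e)\<close> dimensions and the second costs one. With \<rho> = M
  / N, the factor of the index form is \<rho> * \<rho> / \<rho>: each term of the integrand contains
  two derivatives along the curve, and the substitution contributes 1 / \<rho>. It is positive, so
  negative definiteness survives. Derivatives in charts are genuine only off null sets: one-sided
  derivatives at 0 and 1, the times where \<open>N * t\<close> is an integer, and the points where
  an \<open>H1_on\<close> field is not differentiable are all discarded. Two default values need
  separate care: a subspace without a finite basis has \<open>dim\<close> 0, and a nonintegrable
  function has integral 0.\<close>

lemma kernel_basis_card: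
  fixes f :: "'v::real_vector \<Rightarrow> 'f::euclidean_space"
  assumes S: "subspace S" and B: "finite B" "independent B" "span B = S" and f: "linear f"
  obtains B0 where "finite B0" "independent B0" "span B0 = {v\<in>S. f v = 0}"
    "card B \<le> card B0 + DIM('f)"
proof -
  let ?K = "{v\<in>S. f v = 0}"
  have K: "subspace ?K"
    using S f by (auto simp: subspace_def linear_0 linear_add linear_scale)
  obtain B0 where B0: "B0 \<subseteq> ?K" "independent B0" "?K \<subseteq> span B0"
    by (rule maximal_independent_subset)
  have sp: "span B0 = ?K"
    using B0 K by (intro subset_antisym span_minimal)
  have "B0 \<subseteq> S" using B0(1) by blast
  then obtain C where C: "B0 \<subseteq> C" "C \<subseteq> S" "independent C" "S \<subseteq> span C"
    by (rule maximal_independent_subset_extend[OF _ B0(2)])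
  have finC: "finite C" "card C = card B"
  proof -
    have "C \<subseteq> span B" using C B by auto
    then show fC: "finite C" using independent_span_bound[OF B(1) C(3)] by auto
    have "span C = S" using C S by (intro subset_antisym span_minimal)
    then show "card C = card B"
      using dim_span_eq_card_independent[OF C(3)] dim_span_eq_card_independent[OF B(2)] B(3) by simp
  qed
  \<comment> \<open>A vector in the span of \<open>C - B0\<close> that is killed by \<open>f\<close>
    lies in the span of \<open>B0\<close> too. Its coordinates with respect to \<open>C\<close> are
    then supported in two disjoint sets, so they vanish. This is rank-nullity without a
    finite-dimensional ambient space.\<close>
  have inj: "inj_on f (span (C - B0))"
  proof (rule inj_onI)
    fix x y assume xy: "x \<in> span (C - B0)" "y \<in> span (C - B0)" "f x = f y"
    have d: "x - y \<in> span (C - B0)" using xy span_diff by blast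
    have "span (C - B0) \<subseteq> S" using C S by (intro span_minimal) auto
    then have "x - y \<in> span B0" using d xy f by (auto simp: sp linear_diff)
    moreover have "v = 0" if v: "v \<in> span (C - B0)" "v \<in> span B0" for v
    proof -
      have "representation C v = representation (C - B0) v" "representation C v = representation B0 v"
        using v C by (auto intro!: real_vector.representation_extend)
      then have "representation C v b = 0" for b
        using real_vector.representation_ne_zero by (metis DiffD2)
      moreover have "v \<in> span C" using v(2) C(1) span_mono by blast
      ultimately show "v = 0"
        using real_vector.sum_nonzero_representation_eq[OF C(3), of v] by simp
    qed
    ultimately show "x = y" using d by fastforce
  qed
  have "independent (f ` (C - B0))"
    using linear_independent_injective_image[OF f _ inj] C by (meson Diff_subset independent_mono)
  then have "card (f ` (C - B0)) \<le> DIM('f)"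
    using independent_card_le by blast
  moreover have "card (f ` (C - B0)) = card (C - B0)"
    using inj by (meson card_image inj_on_subset span_superset)
  moreover have "card (C - B0) = card C - card B0"
    using finC C(1) by (meson card_Diff_subset finite_subset)
  ultimately have "card B \<le> card B0 + DIM('f)" using finC by simp
  then show ?thesis using that B0(2) sp finC(1) C(1) finite_subset by metis
qed

text \<open>The map used later is linear only on the subspace, because a choice operator makes it
  arbitrary elsewhere. It is replaced by a linear map on the whole space that agrees with it on
  \<open>B\<close>, hence on \<open>S\<close>.\<close>

lemma kernel_basis_card_on:
  fixes \<Lambda> :: "'v::real_vector \<Rightarrow> 'f::euclidean_space"
  assumes S: "subspace S" and B: "finite B" "independent B" "span B = S"
    and add: "\<And>u v. u \<in> S \<Longrightarrow> v \<in> S \<Longrightarrow> \<Lambda> (u + v) = \<Lambda> u + \<Lambda> v"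
    and scale: "\<And>r v. v \<in> S \<Longrightarrow> \<Lambda> (r *\<^sub>R v) = r *\<^sub>R \<Lambda> v"
  obtains B0 where "finite B0" "independent B0" "span B0 = {v\<in>S. \<Lambda> v = 0}"
    "card B \<le> card B0 + DIM('f)"
proof -
  obtain f where f: "linear f" "\<And>x. x \<in> B \<Longrightarrow> f x = \<Lambda> x"
    using linear_independent_extend[OF B(2)] by metis
  have "v \<in> {v\<in>S. f v = \<Lambda> v}" if "v \<in> S" for v
  proof -
    have "v \<in> span B" using that B(3) by simp
    then show ?thesis
    proof (induction rule: span_induct_alt)
      case base
      then show ?case using scale[of 0 0] S f(1) by (simp add: subspace_0 linear_0)
    next
      case (step c x y)
      have x: "x \<in> S" using step B(3) span_base by blast
      then show ?case using step f S
        by (simp add: linear_add linear_scale add scale subspace_add subspace_scale)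
    qed
  qed
  then have "{v\<in>S. f v = 0} = {v\<in>S. \<Lambda> v = 0}" by auto
  then show ?thesis using kernel_basis_card[OF S B f(1)] that by metis
qed

text \<open>
  No finiteness is assumed: \<^const>\<open>Sup\<close> takes the same unspecified value on all infinite sets of
  naturals, and once \<open>D N\<close> is infinite, all later ones are.
\<close>

lemma nondecreasing_correction:
  fixes D :: "nat \<Rightarrow> nat set"
  assumes ne: "\<And>N. 1 \<le> N \<Longrightarrow> D N \<noteq> {}"
    and step: "\<And>N M n. 1 \<le> N \<Longrightarrow> N \<le> M \<Longrightarrow> n \<in> D N \<Longrightarrow> \<exists>m\<in>D M. n \<le> m + K"
  shows "\<exists>d :: nat \<Rightarrow> int. (\<exists>K. \<forall>N\<ge>1. \<bar>d N\<bar> \<le> K) \<and> mono_on {1..} (\<lambda>N. int (Sup (D N)) + d N)"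
proof (cases "\<forall>N\<ge>1. finite (D N)")
  case True
  define \<mu> where "\<mu> = (\<lambda>N. Sup (D N))"
  have \<mu>: "\<mu> N = Max (D N)" if "1 \<le> N" for N using ne[OF that] by (simp add: \<mu>_def Sup_nat_def)
  have le: "\<mu> N \<le> \<mu> M + K" if NM: "1 \<le> N" "N \<le> M" for N M
  proof -
    have "\<mu> N \<in> D N" using True NM ne by (simp add: \<mu>)
    from step[OF NM this] obtain m where m: "m \<in> D M" "\<mu> N \<le> m + K" by blast
    moreover have "m \<le> \<mu> M" using True NM m by (simp add: \<mu>)
    ultimately show ?thesis by simp
  qed
  define d where "d = (\<lambda>N. int (Max (\<mu> ` {1..N})) - int (\<mu> N))"
  have "\<bar>d N\<bar> \<le> int K" if "N \<ge> 1" for N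
  proof -
    have "Max (\<mu> ` {1..N}) \<le> \<mu> N + K" using that le by (subst Max_le_iff) auto
    moreover have "\<mu> N \<le> Max (\<mu> ` {1..N})" using that by (intro Max_ge) auto
    ultimately show ?thesis by (simp add: d_def)
  qed
  moreover have "mono_on {1..} (\<lambda>N. int (\<mu> N) + d N)"
    unfolding d_def by (auto intro!: mono_onI Max_mono)
  ultimately show ?thesis unfolding \<mu>_def by blast
next
  case False
  then obtain N0 where N0: "N0 \<ge> 1" "infinite (D N0)" by blast
  have inf: "infinite (D M)" if "M \<ge> N0" for M
  proof
    assume "finite (D M)"
    then have "n \<le> Max (D M) + K" if "n \<in> D N0" for n
      using step[OF N0(1) \<open>M \<ge> N0\<close> that] by (meson Max_ge add_le_mono1 order_trans)
    then show False using N0(2) by (meson bounded_nat_set_is_finite finite_nat_set_iff_bounded_le)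
  qed
  have Sup: "Sup (D M) = the None" if "M \<ge> N0" for M
    using inf[OF that] by (auto simp: Sup_nat_def Max.infinite)
  \<comment> \<open>From \<open>N0\<close> on all suprema equal the one at \<open>N0\<close>, so
    they are bounded in \<open>N\<close>. The correction may therefore cancel them completely and
    leave the constant sequence 0.\<close>
  have "Sup (D N) \<le> Max ((\<lambda>N. Sup (D N)) ` {..N0})" for N
  proof (cases "N \<le> N0")
    case False
    then have "Sup (D N) = Sup (D N0)" using Sup by simp
    then show ?thesis by auto
  qed auto
  then have "\<forall>N\<ge>1. \<bar>- int (Sup (D N))\<bar> \<le> int (Max ((\<lambda>N. Sup (D N)) ` {..N0}))" by simp
  moreover have "mono_on {1..} (\<lambda>N. int (Sup (D N)) + - int (Sup (D N)))" by (auto intro!: mono_onI)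
  ultimately show ?thesis
    by (intro exI[of _ "\<lambda>N. - int (Sup (D N))"] conjI exI[of _ "int (Max ((\<lambda>N. Sup (D N)) ` {..N0}))"])
qed

subsection \<open>Differential calculus\<close>

abbreviation FD :: "('a::real_normed_vector \<Rightarrow> 'b::real_normed_vector) \<Rightarrow> 'a \<Rightarrow> 'a \<Rightarrow> 'b" where
  "FD f x \<equiv> frechet_derivative f (at x)"

lemma smooth_on_imp_has_derivative:
  assumes "smooth_on S f" "x \<in> S" shows "(f has_derivative FD f x) (at x)"
proof -
  have "Ck_on (Suc 0) S f" using assms(1) unfolding smooth_on_def by blast
  then show ?thesis using assms(2) frechet_derivative_works[of f "at x"] by auto
qed

lemma smooth_on_FD: "smooth_on S f \<Longrightarrow> smooth_on S (\<lambda>x. FD f x v)"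
  unfolding smooth_on_def by (metis Ck_on.simps(2))

lemma smooth_on_imp_continuous_on: "smooth_on S f \<Longrightarrow> continuous_on S f"
  unfolding smooth_on_def by (metis Ck_on.simps(1))

lemma FD_eqI: "(f has_derivative f') (at x) \<Longrightarrow> FD f x = f'"
  by (rule frechet_derivative_at[symmetric])

lemma has_derivative_transform_nhds:
  assumes "(f has_derivative f') (at x)" "\<forall>\<^sub>F y in nhds x. f y = g y"
  shows "(g has_derivative f') (at x)"
proof (rule has_derivative_transform_eventually[OF assms(1)])
  show "\<forall>\<^sub>F y in at x. f y = g y"
    using assms(2) by (simp add: eventually_nhds_conv_at)
  show "f x = g x" using assms(2) by (rule eventually_nhds_x_imp_x)
qed simp

lemma linear_eq_sum_Basis:
  fixes f :: "'e::euclidean_space \<Rightarrow> 'b::real_vector"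
  assumes "linear f"
  shows "f a = (\<Sum>i\<in>Basis. (a \<bullet> i) *\<^sub>R f i)"
proof -
  have "f a = f (\<Sum>i\<in>Basis. (a \<bullet> i) *\<^sub>R i)" by (simp add: euclidean_representation)
  then show ?thesis by (simp add: linear_sum[OF assms] linear_scale[OF assms])
qed

section \<open>Product rules for maps that are linear in further arguments\<close>

text \<open>Expanding \<open>p\<close> in the standard basis reduces this to scalar multiples of
  functions with known derivatives. Linearity is asked only near \<open>x0\<close>, because
  coordinate expressions are linear only inside the image of their chart.\<close>

lemma has_derivative_apply:
  fixes L :: "'a::real_normed_vector \<Rightarrow> 'e::euclidean_space \<Rightarrow> 'b::real_normed_vector"
  assumes lin: "\<forall>\<^sub>F x in nhds x0. linear (L x)"
    and der: "\<And>a. ((\<lambda>x. L x a) has_derivative L' a) (at x0)"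
    and p: "(p has_derivative p') (at x0)"
  shows "((\<lambda>x. L x (p x)) has_derivative (\<lambda>h. L' (p x0) h + L x0 (p' h))) (at x0)"
proof -
  have lin0: "linear (L x0)" using lin by (rule eventually_nhds_x_imp_x)
  have main: "((\<lambda>x. L x (q x)) has_derivative
      (\<lambda>h. \<Sum>i\<in>Basis. (q x0 \<bullet> i) *\<^sub>R L' i h + (q' h \<bullet> i) *\<^sub>R L x0 i)) (at x0)"
    if q: "(q has_derivative q') (at x0)" for q :: "'a \<Rightarrow> 'e" and q'
  proof (rule has_derivative_transform_nhds)
    show "((\<lambda>x. \<Sum>i\<in>Basis. (q x \<bullet> i) *\<^sub>R L x i) has_derivative
      (\<lambda>h. \<Sum>i\<in>Basis. (q x0 \<bullet> i) *\<^sub>R L' i h + (q' h \<bullet> i) *\<^sub>R L x0 i)) (at x0)"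
      by (intro has_derivative_sum has_derivative_scaleR has_derivative_inner_left q der)
    show "\<forall>\<^sub>F y in nhds x0. (\<Sum>i\<in>Basis. (q y \<bullet> i) *\<^sub>R L y i) = L y (q y)"
      using lin by eventually_elim (metis linear_eq_sum_Basis)
  qed
  \<comment> \<open>For the constant function \<open>a\<close> the expansion must reproduce
    \<open>der\<close>. By uniqueness of derivatives this makes \<open>L'\<close> linear in its
    first argument.\<close>
  have "L' a = (\<lambda>h. \<Sum>i\<in>Basis. (a \<bullet> i) *\<^sub>R L' i h)" for a
    using has_derivative_unique[OF der[of a] main[OF has_derivative_const]] by simp
  then have 1: "(\<Sum>i\<in>Basis. (p x0 \<bullet> i) *\<^sub>R L' i h) = L' (p x0) h" for h
    by (rule fun_cong[THEN sym])
  have "(\<Sum>i\<in>Basis. (p x0 \<bullet> i) *\<^sub>R L' i h + (p' h \<bullet> i) *\<^sub>R L x0 i) = L' (p x0) h + L x0 (p' h)" for h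
    by (simp add: sum.distrib 1 linear_eq_sum_Basis[OF lin0, of "p' h"])
  then show ?thesis using main[OF p] by simp
qed

lemma has_derivative_apply2:
  fixes F :: "'a::real_normed_vector \<Rightarrow> 'e::euclidean_space \<Rightarrow> 'f::euclidean_space \<Rightarrow> 'b::real_normed_vector"
  assumes bil: "\<forall>\<^sub>F x in nhds x0. bilinear (F x)"
    and der: "\<And>a b. ((\<lambda>x. F x a b) has_derivative F' a b) (at x0)"
    and p: "(p has_derivative p') (at x0)"
    and q: "(q has_derivative q') (at x0)"
  shows "((\<lambda>x. F x (p x) (q x)) has_derivative
    (\<lambda>h. F' (p x0) (q x0) h + F x0 (p' h) (q x0) + F x0 (p x0) (q' h))) (at x0)"
proof -
  have 1: "((\<lambda>x. F x (p x) b) has_derivative (\<lambda>h. F' (p x0) b h + F x0 (p' h) b)) (at x0)" for b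
    by (rule has_derivative_apply[where L = "\<lambda>x a. F x a b" and L' = "\<lambda>a. F' a b", OF _ der p])
       (use bil in \<open>eventually_elim, simp add: bilinear_def\<close>)
  show ?thesis
    by (rule has_derivative_apply[where L = "\<lambda>x. F x (p x)"
          and L' = "\<lambda>b h. F' (p x0) b h + F x0 (p' h) b", OF _ 1 q])
       (use bil in \<open>eventually_elim, simp add: bilinear_def\<close>)
qed

lemma linear_FD_parameter:
  assumes lin: "\<forall>\<^sub>F y in nhds x. linear (L y)"
    and diff: "\<And>a. (\<lambda>y. L y a) differentiable (at x)"
  shows "linear (\<lambda>a. FD (\<lambda>y. L y a) x h)"
proof (rule linearI)
  have d: "((\<lambda>y. L y a) has_derivative FD (\<lambda>y. L y a) x) (at x)" for a
    using diff frechet_derivative_works by blast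
  fix a b
  have "((\<lambda>y. L y (a + b)) has_derivative (\<lambda>h. FD (\<lambda>y. L y a) x h + FD (\<lambda>y. L y b) x h)) (at x)"
    by (rule has_derivative_transform_nhds[OF has_derivative_add[OF d d]])
       (use lin in \<open>eventually_elim, simp add: linear_add\<close>)
  then show "FD (\<lambda>y. L y (a + b)) x h = FD (\<lambda>y. L y a) x h + FD (\<lambda>y. L y b) x h"
    by (simp add: FD_eqI)
  fix r
  have "((\<lambda>y. L y (r *\<^sub>R a)) has_derivative (\<lambda>h. r *\<^sub>R FD (\<lambda>y. L y a) x h)) (at x)"
    by (rule has_derivative_transform_nhds[OF has_derivative_scaleR_right[OF d]])
       (use lin in \<open>eventually_elim, simp add: linear_scale\<close>)
  then show "FD (\<lambda>y. L y (r *\<^sub>R a)) x h = r *\<^sub>R FD (\<lambda>y. L y a) x h"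
    by (simp add: FD_eqI)
qed

section \<open>Symmetry of second derivatives\<close>

text \<open>The second difference is an increment in direction \<open>u\<close> of the difference of
  \<open>f\<close> between two parallel segments. The mean value theorem along \<open>u\<close>, and
  then for \<open>f' _ u\<close> along \<open>v\<close>, produces the point
  \<open>y\<close>.\<close>

lemma second_difference_mean_value:
  fixes f :: "'a::real_normed_vector \<Rightarrow> real"
  assumes f: "\<And>y. y \<in> ball x \<delta> \<Longrightarrow> (f has_derivative f' y) (at y)"
    and fu: "\<And>y. y \<in> ball x \<delta> \<Longrightarrow> ((\<lambda>z. f' z u) has_derivative fu' y) (at y)"
    and h: "h > 0" "h * (norm u + norm v) < \<delta>"
  shows "\<exists>y\<in>ball x \<delta>. f (x + h *\<^sub>R u + h *\<^sub>R v) - f (x + h *\<^sub>R u) - f (x + h *\<^sub>R v) + f x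
    = h * (h * fu' y v)"
proof -
  have in_ball: "x + s *\<^sub>R u + t *\<^sub>R v \<in> ball x \<delta>" if "0 \<le> s" "s \<le> h" "0 \<le> t" "t \<le> h" for s t
  proof -
    have "norm (s *\<^sub>R u + t *\<^sub>R v) \<le> s * norm u + t * norm v"
      using norm_triangle_ineq[of "s *\<^sub>R u" "t *\<^sub>R v"] that by simp
    also have "\<dots> \<le> h * (norm u + norm v)"
      unfolding distrib_left using that by (intro add_mono mult_right_mono) auto
    finally have "norm (s *\<^sub>R u + t *\<^sub>R v) < \<delta>" using h by simp
    moreover have "dist x (x + s *\<^sub>R u + t *\<^sub>R v) = norm (s *\<^sub>R u + t *\<^sub>R v)"
      unfolding dist_norm by (metis add.assoc add_diff_cancel_left' norm_minus_commute)
    ultimately show ?thesis by simp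
  qed
  have line: "((\<lambda>s. k (y + s *\<^sub>R w)) has_real_derivative k' w) (at s)"
    if k: "(k has_derivative k') (at (y + s *\<^sub>R w))" for k :: "'a \<Rightarrow> real" and k' y w s
  proof -
    have "((\<lambda>s. y + s *\<^sub>R w) has_derivative (\<lambda>h. h *\<^sub>R w)) (at s)"
      by (auto intro!: derivative_eq_intros)
    from has_derivative_compose[OF this k]
    have "((\<lambda>s. k (y + s *\<^sub>R w)) has_derivative (\<lambda>h. k' (h *\<^sub>R w))) (at s)" .
    moreover have "k' (h *\<^sub>R w) = k' w * h" for h
      using linear_scale[OF has_derivative_linear[OF k]] by simp
    ultimately show ?thesis by (simp add: has_field_derivative_def fun_eq_iff)
  qed
  define \<phi> where "\<phi> = (\<lambda>s. f ((x + h *\<^sub>R v) + s *\<^sub>R u) - f (x + s *\<^sub>R u))"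
  have "(\<phi> has_real_derivative f' ((x + h *\<^sub>R v) + s *\<^sub>R u) u - f' (x + s *\<^sub>R u) u) (at s)"
    if "0 \<le> s" "s \<le> h" for s
    unfolding \<phi>_def using that h in_ball[of s h] in_ball[of s 0]
    by (intro DERIV_diff line f) (simp_all add: algebra_simps)
  from MVT2[OF h(1) this] obtain \<xi> where \<xi>: "0 < \<xi>" "\<xi> < h"
    "\<phi> h - \<phi> 0 = (h - 0) * (f' ((x + h *\<^sub>R v) + \<xi> *\<^sub>R u) u - f' (x + \<xi> *\<^sub>R u) u)" by blast
  have "((\<lambda>t. f' ((x + \<xi> *\<^sub>R u) + t *\<^sub>R v) u) has_real_derivative
      fu' ((x + \<xi> *\<^sub>R u) + t *\<^sub>R v) v) (at t)" if "0 \<le> t" "t \<le> h" for t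
    using that \<xi> in_ball[of \<xi> t] by (intro line[where k = "\<lambda>z. f' z u"] fu) auto
  from MVT2[OF h(1) this] obtain \<eta> where \<eta>: "0 < \<eta>" "\<eta> < h"
    "f' ((x + \<xi> *\<^sub>R u) + h *\<^sub>R v) u - f' ((x + \<xi> *\<^sub>R u) + 0 *\<^sub>R v) u
      = (h - 0) * fu' ((x + \<xi> *\<^sub>R u) + \<eta> *\<^sub>R v) v" by blast
  have "f (x + h *\<^sub>R u + h *\<^sub>R v) - f (x + h *\<^sub>R u) - f (x + h *\<^sub>R v) + f x = \<phi> h - \<phi> 0"
    by (simp add: \<phi>_def algebra_simps)
  also have "\<dots> = h * (h * fu' ((x + \<xi> *\<^sub>R u) + \<eta> *\<^sub>R v) v)"
    using \<xi>(3) \<eta>(3) by (simp add: add_ac)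
  finally show ?thesis using in_ball[of \<xi> \<eta>] \<xi> \<eta> by (intro bexI) auto
qed

text \<open>The second difference is symmetric in \<open>u\<close> and \<open>v\<close>. Hence it
  equals h * h times either mixed derivative, each at some point of an arbitrarily small ball, and
  continuity at \<open>x\<close> forces the two to agree there.\<close>

lemma mixed_derivatives_eq:
  fixes f :: "'a::real_normed_vector \<Rightarrow> real"
  assumes S: "open S" "x \<in> S"
    and f: "\<And>y. y \<in> S \<Longrightarrow> (f has_derivative f' y) (at y)"
    and fu: "\<And>y. y \<in> S \<Longrightarrow> ((\<lambda>z. f' z u) has_derivative fu' y) (at y)"
    and fv: "\<And>y. y \<in> S \<Longrightarrow> ((\<lambda>z. f' z v) has_derivative fv' y) (at y)"
    and cont: "continuous (at x) (\<lambda>y. fu' y v)" "continuous (at x) (\<lambda>y. fv' y u)"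
  shows "fu' x v = fv' x u"
proof (rule ccontr)
  define a where "a = (\<lambda>y. fu' y v)"
  define b where "b = (\<lambda>y. fv' y u)"
  assume "fu' x v \<noteq> fv' x u"
  then have ne: "dist (a x) (b x) > 0" by (simp add: a_def b_def)
  then have ne2: "dist (a x) (b x) / 2 > 0" by simp
  obtain d1 where d1: "d1 > 0" "\<And>y. dist y x < d1 \<Longrightarrow> dist (a y) (a x) < dist (a x) (b x) / 2"
    using cont(1) ne2 unfolding continuous_at_eps_delta a_def[symmetric] by metis
  obtain d2 where d2: "d2 > 0" "\<And>y. dist y x < d2 \<Longrightarrow> dist (b y) (b x) < dist (a x) (b x) / 2"
    using cont(2) ne2 unfolding continuous_at_eps_delta b_def[symmetric] by metis
  obtain d3 where d3: "d3 > 0" "ball x d3 \<subseteq> S" using S openE by blast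
  define \<delta> where "\<delta> = Min {d1, d2, d3}"
  have \<delta>: "\<delta> > 0" "\<delta> \<le> d1" "\<delta> \<le> d2" "ball x \<delta> \<subseteq> S"
    using d1(1) d2(1) d3 subset_ball[of \<delta> d3 x] by (auto simp: \<delta>_def)
  \<comment> \<open>This size keeps the parallelogram spanned by h u and h v at \<open>x\<close>
    inside the ball; the summand 1 covers the case that both vectors vanish.\<close>
  define h where "h = \<delta> / (norm u + norm v + 1)"
  have pos: "norm u + norm v + 1 > 0" by (smt (verit) norm_ge_zero)
  have "h > 0" using \<delta>(1) pos by (simp add: h_def)
  have "h * (norm u + norm v + 1) = \<delta>" using pos by (simp add: h_def)
  then have h: "h > 0" "h * (norm u + norm v) < \<delta>" "h * (norm v + norm u) < \<delta>"
    using \<open>h > 0\<close> by (simp_all add: algebra_simps)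
  obtain y1 where y1: "y1 \<in> ball x \<delta>"
    "f (x + h *\<^sub>R u + h *\<^sub>R v) - f (x + h *\<^sub>R u) - f (x + h *\<^sub>R v) + f x = h * (h * a y1)"
    using second_difference_mean_value[of x \<delta> f f' u fu' h v] f fu \<delta>(4) h(1,2) unfolding a_def by blast
  obtain y2 where y2: "y2 \<in> ball x \<delta>"
    "f (x + h *\<^sub>R v + h *\<^sub>R u) - f (x + h *\<^sub>R v) - f (x + h *\<^sub>R u) + f x = h * (h * b y2)"
    using second_difference_mean_value[of x \<delta> f f' v fv' h u] f fv \<delta>(4) h(1,3) unfolding b_def by blast
  have "h * (h * a y1) = h * (h * b y2)" using y1(2) y2(2) by (simp add: algebra_simps)
  then have "a y1 = b y2" using h(1) by simp
  moreover have "dist (a y1) (a x) < dist (a x) (b x) / 2" "dist (b y2) (b x) < dist (a x) (b x) / 2"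
    using d1(2)[of y1] d2(2)[of y2] y1(1) y2(1) \<delta>(2,3) by (auto simp: dist_commute)
  ultimately show False
    using dist_triangle[of "a x" "b x" "a y1"] by (simp add: dist_commute)
qed

lemma FD_FD_commute:
  fixes f :: "'a::real_normed_vector \<Rightarrow> 'b::euclidean_space"
  assumes S: "open S" "x \<in> S" and f: "smooth_on S f"
  shows "FD (\<lambda>y. FD f y u) x v = FD (\<lambda>y. FD f y v) x u"
proof (rule euclidean_eqI)
  fix i :: 'b
  show "FD (\<lambda>y. FD f y u) x v \<bullet> i = FD (\<lambda>y. FD f y v) x u \<bullet> i"
  proof (rule mixed_derivatives_eq[OF S, where f = "\<lambda>y. f y \<bullet> i" and f' = "\<lambda>y w. FD f y w \<bullet> i"
        and fu' = "\<lambda>y w. FD (\<lambda>y. FD f y u) y w \<bullet> i" and fv' = "\<lambda>y w. FD (\<lambda>y. FD f y v) y w \<bullet> i"])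
    have "continuous_on S (\<lambda>y. FD (\<lambda>y. FD f y a) y b \<bullet> i)" for a b
      by (intro continuous_intros smooth_on_imp_continuous_on smooth_on_FD f)
    then show "continuous (at x) (\<lambda>y. FD (\<lambda>y. FD f y u) y v \<bullet> i)"
      "continuous (at x) (\<lambda>y. FD (\<lambda>y. FD f y v) y u \<bullet> i)"
      using S continuous_on_eq_continuous_at by blast+
  qed (auto intro!: has_derivative_inner_left smooth_on_imp_has_derivative smooth_on_FD f)
qed

section \<open>Differentiability of solutions of linear systems\<close>

text \<open>A factor that is merely continuous can be tolerated in the product rule where the other
  factor vanishes: the extra term (f y - f x) k y is o(1) times O(|y - x|).\<close>

lemma has_derivative_scaleR_vanishing:
  fixes f :: "'a::real_normed_vector \<Rightarrow> real" and k :: "'a \<Rightarrow> 'b::real_normed_vector"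
  assumes f: "continuous (at x) f" and k: "(k has_derivative k') (at x)" and k0: "k x = 0"
  shows "((\<lambda>y. f y *\<^sub>R k y) has_derivative (\<lambda>h. f x *\<^sub>R k' h)) (at x)"
  unfolding has_derivative_at_alt
proof (intro conjI allI impI)
  have bl: "bounded_linear k'" using k by (rule has_derivative_bounded_linear)
  then show "bounded_linear (\<lambda>h. f x *\<^sub>R k' h)" by (rule bounded_linear_const_scaleR)
  fix e :: real assume "e > 0"
  obtain K where K: "K > 0" "\<And>h. norm (k' h) \<le> norm h * K"
    using bounded_linear.pos_bounded[OF bl] by blast
  \<comment> \<open>Each of the two error terms gets half of \<open>e\<close>. The bound
    \<open>e2 \<le> 1\<close> moreover yields the Lipschitz estimate for \<open>k\<close> at
    \<open>x\<close> with constant \<open>K + 1\<close>.\<close>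
  define e1 where "e1 = e / (2 * (K + 1))"
  define e2 where "e2 = min 1 (e / (2 * (\<bar>f x\<bar> + 1)))"
  have e12: "e1 > 0" "e2 > 0" using \<open>e > 0\<close> K by (auto simp: e1_def e2_def)
  obtain d1 where d1: "d1 > 0" "\<And>y. dist y x < d1 \<Longrightarrow> dist (f y) (f x) < e1"
    using f e12(1) unfolding continuous_at_eps_delta by metis
  obtain d2 where d2: "d2 > 0" "\<And>y. norm (y - x) < d2 \<Longrightarrow> norm (k y - k x - k' (y - x)) \<le> e2 * norm (y - x)"
    using k e12(2) unfolding has_derivative_at_alt by metis
  show "\<exists>d>0. \<forall>y. norm (y - x) < d \<longrightarrow>
     norm (f y *\<^sub>R k y - f x *\<^sub>R k x - f x *\<^sub>R k' (y - x)) \<le> e * norm (y - x)"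
  proof (intro exI conjI allI impI)
    show "min d1 d2 > 0" using d1 d2 by simp
    fix y assume y: "norm (y - x) < min d1 d2"
    have 1: "norm (k y - k' (y - x)) \<le> e2 * norm (y - x)" using d2(2)[of y] y k0 by simp
    have 2: "\<bar>f y - f x\<bar> \<le> e1" using d1(2)[of y] y by (simp add: dist_norm)
    have "norm (k y) \<le> norm (k y - k' (y - x)) + norm (k' (y - x))"
      by (metis diff_add_cancel norm_triangle_ineq)
    also have "\<dots> \<le> e2 * norm (y - x) + norm (y - x) * K" using 1 K by (intro add_mono) auto
    also have "\<dots> \<le> (K + 1) * norm (y - x)"
      using mult_right_mono[of e2 1 "norm (y - x)"] by (simp add: e2_def algebra_simps)
    finally have 3: "norm (k y) \<le> (K + 1) * norm (y - x)" .
    have "norm (f y *\<^sub>R k y - f x *\<^sub>R k x - f x *\<^sub>R k' (y - x))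
      = norm ((f y - f x) *\<^sub>R k y + f x *\<^sub>R (k y - k' (y - x)))"
      by (simp add: k0 algebra_simps)
    also have "\<dots> \<le> \<bar>f y - f x\<bar> * norm (k y) + \<bar>f x\<bar> * norm (k y - k' (y - x))"
      by (metis norm_scaleR norm_triangle_ineq)
    also have "\<dots> \<le> e1 * ((K + 1) * norm (y - x)) + (\<bar>f x\<bar> + 1) * (e2 * norm (y - x))"
      using 1 2 3 e12 by (intro add_mono mult_mono) auto
    also have "\<dots> \<le> e * norm (y - x)"
    proof -
      have "e1 * (K + 1) = e / 2" using K by (simp add: e1_def field_simps)
      moreover have "(\<bar>f x\<bar> + 1) * e2 \<le> (\<bar>f x\<bar> + 1) * (e / (2 * (\<bar>f x\<bar> + 1)))"
        by (intro mult_left_mono) (auto simp: e2_def)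
      moreover have "(\<bar>f x\<bar> + 1) * (e / (2 * (\<bar>f x\<bar> + 1))) = e / 2" by (simp add: field_simps)
      ultimately have "e1 * (K + 1) + (\<bar>f x\<bar> + 1) * e2 \<le> e" by linarith
      from mult_right_mono[OF this norm_ge_zero[of "y - x"]] show ?thesis
        by (simp add: algebra_simps)
    qed
    finally show "norm (f y *\<^sub>R k y - f x *\<^sub>R k x - f x *\<^sub>R k' (y - x)) \<le> e * norm (y - x)" .
  qed
qed

text \<open>Serves for the Christoffel symbols, which are given only implicitly. With a left inverse
  \<open>C\<close> of \<open>B x\<close> and \<open>E y = B y - B x\<close>, the solution satisfies
  z y = z x + C (\<rho> y - \<rho> x) - C (E y (z y)). This identity is used twice, first for
  continuity of \<open>z\<close> at \<open>x\<close>, then for differentiability.\<close>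

lemma differentiable_solution_linear_system:
  fixes B :: "'a::real_normed_vector \<Rightarrow> 'e::euclidean_space \<Rightarrow> 'e"
  assumes lin: "\<forall>\<^sub>F y in nhds x. linear (B y)"
    and diff: "\<And>a. (\<lambda>y. B y a) differentiable (at x)"
    and inj: "inj (B x)"
    and \<rho>: "\<rho> differentiable (at x)"
    and sol: "\<forall>\<^sub>F y in nhds x. B y (z y) = \<rho> y"
  shows "z differentiable (at x)"
proof -
  have linx: "linear (B x)" and solx: "B x (z x) = \<rho> x"
    using lin sol by (auto dest: eventually_nhds_x_imp_x)
  obtain C where C: "linear C" "\<And>a. C (B x a) = a"
    using linear_injective_left_inverse[OF linx inj] by (metis comp_apply id_apply)
  define E where "E = (\<lambda>y a. B y a - B x a)"
  have E: "E y (z y) = (\<Sum>i\<in>Basis. (z y \<bullet> i) *\<^sub>R E y i)" if "linear (B y)" for y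
    using linear_eq_sum_Basis[OF linear_compose_sub[OF that linx], of "z y"] by (simp add: E_def)
  have zeq: "\<forall>\<^sub>F y in nhds x. z x + C (\<rho> y - \<rho> x) - C (\<Sum>i\<in>Basis. (z y \<bullet> i) *\<^sub>R E y i) = z y"
    using lin sol
  proof eventually_elim
    case (elim y)
    have "\<rho> y - \<rho> x - E y (z y) = B x (z y - z x)"
      using elim solx by (simp add: E_def linear_diff[OF linx])
    then have "C (\<rho> y - \<rho> x - E y (z y)) = z y - z x" using C by simp
    then show ?case using E[OF elim(1)] by (simp add: linear_diff[OF C(1)] linear_add[OF C(1)] algebra_simps)
  qed
  have Ediff: "((\<lambda>y. E y a) has_derivative FD (\<lambda>y. B y a) x) (at x)" for a
    unfolding E_def
    using has_derivative_diff[OF diff[of a, unfolded frechet_derivative_works] has_derivative_const[of "B x a"]]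
    by simp
  obtain K where K: "K > 0" "\<And>a. norm (C a) \<le> K * norm a"
    using linear_bounded_pos[OF C(1)] by blast
  define e where "e = (\<lambda>y. \<Sum>i\<in>Basis. norm (E y i))"
  have "((\<lambda>y. E y i) \<longlongrightarrow> 0) (at x)" for i
    using has_derivative_continuous[OF Ediff[of i]] by (simp add: continuous_at E_def)
  then have "((\<lambda>y. norm (E y i)) \<longlongrightarrow> 0) (at x)" for i by (rule tendsto_norm_zero)
  then have e0: "(e \<longlongrightarrow> 0) (at x)" unfolding e_def by (intro tendsto_null_sum)
  have r0: "((\<lambda>y. norm (\<rho> y - \<rho> x)) \<longlongrightarrow> 0) (at x)"
    using differentiable_imp_continuous_within[OF \<rho>]
    by (simp add: continuous_at tendsto_norm_zero_iff LIM_zero_iff)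
  \<comment> \<open>Once \<open>K * e y < 1 / 2\<close>, the term with
    \<open>norm (z y - z x)\<close> on the right of the estimate is absorbed into the left-hand
    side.\<close>
  have small: "\<forall>\<^sub>F y in at x. K * e y < 1 / 2"
  proof -
    have "((\<lambda>y. K * e y) \<longlongrightarrow> K * 0) (at x)" by (intro tendsto_intros e0)
    then show ?thesis by (rule order_tendstoD) simp
  qed
  have "((\<lambda>y. z y - z x) \<longlongrightarrow> 0) (at x)"
  proof (rule Lim_null_comparison)
    show "\<forall>\<^sub>F y in at x. norm (z y - z x) \<le> 2 * K * (norm (\<rho> y - \<rho> x) + e y * norm (z x))"
      using small eventually_nhds_conv_at[THEN iffD1, OF zeq, THEN conjunct1]
    proof eventually_elim
      case (elim y)
      let ?s = "\<Sum>i\<in>Basis. (z y \<bullet> i) *\<^sub>R E y i"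
      have ey: "e y \<ge> 0" by (simp add: e_def sum_nonneg)
      have "norm ?s \<le> (\<Sum>i\<in>Basis. norm (z y) * norm (E y i))"
        by (intro sum_norm_le) (auto intro!: mult_right_mono Basis_le_norm)
      then have s: "norm ?s \<le> norm (z y) * e y" by (simp add: e_def sum_distrib_left)
      have "z y - z x = C (\<rho> y - \<rho> x) - C ?s"
        by (subst elim(2)[symmetric]) simp
      then have "norm (z y - z x) = norm (C (\<rho> y - \<rho> x) - C ?s)" by simp
      also have "\<dots> \<le> norm (C (\<rho> y - \<rho> x)) + norm (C ?s)" by (rule norm_triangle_ineq4)
      also have "\<dots> \<le> K * norm (\<rho> y - \<rho> x) + K * (norm (z y) * e y)"
        using K(2)[of "\<rho> y - \<rho> x"] order_trans[OF K(2)[of ?s] mult_left_mono[OF s]] K(1)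
        by (intro add_mono) auto
      also have "\<dots> \<le> K * norm (\<rho> y - \<rho> x) + K * ((norm (z y - z x) + norm (z x)) * e y)"
        using K(1) ey norm_triangle_ineq[of "z y - z x" "z x"]
        by (intro add_left_mono mult_left_mono mult_right_mono) auto
      also have "\<dots> = K * norm (\<rho> y - \<rho> x) + (K * e y) * norm (z y - z x) + K * e y * norm (z x)"
        by (simp add: algebra_simps)
      also have "\<dots> \<le> K * norm (\<rho> y - \<rho> x) + 1/2 * norm (z y - z x) + K * e y * norm (z x)"
        using elim(1) by (intro add_right_mono add_left_mono mult_right_mono) auto
      finally have "norm (z y - z x) \<le> 2 * (K * norm (\<rho> y - \<rho> x)) + 2 * (K * e y * norm (z x))"
        by linarith
      then show ?case by (simp add: distrib_left mult.assoc)
    qed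
    have "((\<lambda>y. 2 * K * (norm (\<rho> y - \<rho> x) + e y * norm (z x))) \<longlongrightarrow> 2 * K * (0 + 0 * norm (z x))) (at x)"
      by (intro tendsto_intros r0 e0)
    then show "((\<lambda>y. 2 * K * (norm (\<rho> y - \<rho> x) + e y * norm (z x))) \<longlongrightarrow> 0) (at x)" by simp
  qed
  then have zc: "continuous (at x) z" by (simp add: continuous_at LIM_zero_iff)
  \<comment> \<open>The coefficient \<open>z y \<bullet> i\<close> is only known to be continuous at
    this point, but \<open>E y i\<close> vanishes at \<open>y = x\<close>.\<close>
  have zi: "((\<lambda>y. (z y \<bullet> i) *\<^sub>R E y i) has_derivative (\<lambda>h. (z x \<bullet> i) *\<^sub>R FD (\<lambda>y. B y i) x h)) (at x)" for i
    by (rule has_derivative_scaleR_vanishing[OF _ Ediff]) (auto intro!: continuous_intros zc simp: E_def)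
  have blC: "bounded_linear C" using C(1) by (simp add: linear_conv_bounded_linear)
  have "((\<lambda>y. \<rho> y - \<rho> x) has_derivative FD \<rho> x) (at x)"
    using has_derivative_diff[OF \<rho>[unfolded frechet_derivative_works] has_derivative_const[of "\<rho> x"]]
    by simp
  then have "((\<lambda>y. z x + C (\<rho> y - \<rho> x) - C (\<Sum>i\<in>Basis. (z y \<bullet> i) *\<^sub>R E y i)) has_derivative
     (\<lambda>h. 0 + C (FD \<rho> x h) - C (\<Sum>i\<in>Basis. (z x \<bullet> i) *\<^sub>R FD (\<lambda>y. B y i) x h))) (at x)"
    by (intro has_derivative_diff has_derivative_add has_derivative_const has_derivative_sum zi
        bounded_linear.has_derivative[OF blC])
  from has_derivative_transform_nhds[OF this zeq] show ?thesis by (auto simp: differentiable_def)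
qed

lemma at_within_01: "0 < t \<Longrightarrow> t < 1 \<Longrightarrow> at t within {0..1} = at (t::real)"
  by (simp add: at_within_Icc_at)

lemma has_vector_derivative_compose_linear:
  assumes "(f has_derivative f') (at (x t))" "(x has_vector_derivative v) (at t)"
  shows "((\<lambda>s. f (x s)) has_vector_derivative f' v) (at t)"
  using has_derivative_compose[OF assms(2)[unfolded has_vector_derivative_def] assms(1)]
    linear_scale[OF has_derivative_linear[OF assms(1)]]
  by (simp add: has_vector_derivative_def)

lemma has_vector_derivative_rescale:
  assumes "(f has_vector_derivative f') (at (r * s))"
  shows "((\<lambda>s. f (r * s)) has_vector_derivative r *\<^sub>R f') (at s)"
proof -
  have "((\<lambda>s. r * s) has_vector_derivative r) (at s)"
    by (auto intro!: derivative_eq_intros simp: has_vector_derivative_def)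
  from vector_diff_chain_at[OF this assms] show ?thesis by (simp add: o_def)
qed

subsection \<open>Differentiation of indefinite integrals\<close>

text \<open>
  Bad intervals with the point \<open>x\<close> as an end point form a Vitali cover of the bad set, and Henstock's
  lemma, with \<open>x\<close> as the tag, bounds the total length of disjoint ones.
\<close>

lemma negligible_not_differentiable_integral:
  fixes w :: "real \<Rightarrow> 'e::euclidean_space"
  assumes w: "w integrable_on {a..b}"
  shows "negligible {t\<in>{a<..<b}. \<not> ((\<lambda>t. integral {a..t} w) has_vector_derivative w t) (at t)}"
proof -
  define F where "F = (\<lambda>t. integral {a..t} w)"
  define Bad where "Bad = (\<lambda>n::nat. {x\<in>{a<..<b}. \<forall>d>0. \<exists>y. \<bar>y - x\<bar> < d \<and>
     norm (F y - F x - (y - x) *\<^sub>R w x) > inverse (real (Suc n)) * \<bar>y - x\<bar>})"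
  have sub: "{t\<in>{a<..<b}. \<not> (F has_vector_derivative w t) (at t)} \<subseteq> (\<Union>n. Bad n)"
  proof
    fix x assume "x \<in> {t\<in>{a<..<b}. \<not> (F has_vector_derivative w t) (at t)}"
    then have x: "x \<in> {a<..<b}" and nd: "\<not> (F has_derivative (\<lambda>h. h *\<^sub>R w x)) (at x)"
      by (auto simp: has_vector_derivative_def)
    have "bounded_linear (\<lambda>h. h *\<^sub>R w x)" by (rule bounded_linear_scaleR_left)
    then obtain e where "e > 0" and e: "\<And>d. d > 0 \<Longrightarrow> \<exists>y. \<bar>y - x\<bar> < d \<and>
         norm (F y - F x - (y - x) *\<^sub>R w x) > e * \<bar>y - x\<bar>"
      using nd unfolding has_derivative_at_alt by (force simp: not_le)
    obtain n where n: "inverse (real (Suc n)) < e" using reals_Archimedean \<open>e > 0\<close> by blast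
    have "x \<in> Bad n" unfolding Bad_def
    proof (safe intro!: x)
      fix d :: real assume "d > 0"
      then obtain y where "\<bar>y - x\<bar> < d" "norm (F y - F x - (y - x) *\<^sub>R w x) > e * \<bar>y - x\<bar>"
        using e by blast
      moreover have "inverse (real (Suc n)) * \<bar>y - x\<bar> \<le> e * \<bar>y - x\<bar>"
        using n by (intro mult_right_mono) auto
      ultimately show "\<exists>y. \<bar>y - x\<bar> < d \<and>
        norm (F y - F x - (y - x) *\<^sub>R w x) > inverse (real (Suc n)) * \<bar>y - x\<bar>" by force
    qed
    then show "x \<in> (\<Union>n. Bad n)" by blast
  qed
  have "negligible (Bad n)" for n
  proof -
    define e where "e = inverse (real (Suc n))"
    have "e > 0" by (simp add: e_def)
    show ?thesis unfolding negligible_outer_le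
    proof (intro allI impI)
      fix \<eta> :: real assume "\<eta> > 0"
      then have "e * \<eta> > 0" using \<open>e > 0\<close> by simp
      then obtain d where d: "gauge d" and
        dp: "\<And>p. \<lbrakk>p tagged_partial_division_of (cbox a b); d fine p\<rbrakk> \<Longrightarrow>
             sum (\<lambda>(x,k). norm (measure lborel k *\<^sub>R w x - integral k w)) p < e * \<eta>"
        using Henstock_lemma[of w a b "e * \<eta>"] w by auto
      \<comment> \<open>A pair stands for the interval between a bad point \<open>x\<close> and a
        witness \<open>y\<close> on either side of it. Midpoint and half length turn it into the
        closed ball that Vitali's theorem expects.\<close>
      define k where "k = (\<lambda>(x::real, y). {min x y..max x y})"
      define K where "K = {(x, y). x \<in> Bad n \<and> y \<in> {a<..<b} \<and>
         norm (F y - F x - (y - x) *\<^sub>R w x) > e * \<bar>y - x\<bar> \<and> k (x, y) \<subseteq> d x}"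
      let ?c = "\<lambda>(x::real, y). (x + y) / 2" and ?r = "\<lambda>(x::real, y). \<bar>y - x\<bar> / 2"
      have cb: "cball (?c i) (?r i) = k i" for i
      proof (cases i)
        case (Pair x y)
        have h: "\<bar>y - x\<bar> = max x y - min x y" "x + y = max x y + min x y" by auto
        show ?thesis unfolding Pair prod.case cball_eq_atLeastAtMost k_def h
          by (simp add: field_simps)
      qed
      have ne: "snd i \<noteq> fst i" if "i \<in> K" for i using that by (auto simp: K_def)
      obtain C where C: "countable C" "C \<subseteq> K"
        and dis: "pairwise (\<lambda>i j. disjnt (cball (?c i) (?r i)) (cball (?c j) (?r j))) C"
        and neg: "negligible (Bad n - (\<Union>i\<in>C. cball (?c i) (?r i)))"
      proof (rule Vitali_covering_theorem_cballs[of K ?r "Bad n" ?c])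
        show "0 < ?r i" if "i \<in> K" for i using ne[OF that] by (auto split: prod.split)
        fix x \<delta> :: real assume x: "x \<in> Bad n" and "\<delta> > 0"
        have "open (d x)" "x \<in> d x" using d by (auto simp: gauge_def)
        then obtain \<epsilon> where \<epsilon>: "\<epsilon> > 0" "ball x \<epsilon> \<subseteq> d x" using openE by blast
        have xab: "a < x" "x < b" using x by (auto simp: Bad_def)
        define \<delta>' where "\<delta>' = Min {\<delta>, \<epsilon>, x - a, b - x}"
        have "\<delta>' > 0" using \<open>\<delta> > 0\<close> \<epsilon> xab by (simp add: \<delta>'_def)
        have \<delta>': "\<delta>' \<le> \<delta>" "\<delta>' \<le> \<epsilon>" "\<delta>' \<le> x - a" "\<delta>' \<le> b - x" by (auto simp: \<delta>'_def)
        obtain y where y: "\<bar>y - x\<bar> < \<delta>'" "norm (F y - F x - (y - x) *\<^sub>R w x) > e * \<bar>y - x\<bar>"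
          using x \<open>\<delta>' > 0\<close> unfolding Bad_def e_def by blast
        have "k (x, y) \<subseteq> ball x \<epsilon>" using y(1) \<delta>'(2) by (auto simp: k_def dist_real_def)
        then have "(x, y) \<in> K" using x y \<epsilon> \<delta>' by (auto simp: K_def)
        moreover have "x \<in> cball (?c (x, y)) (?r (x, y))" unfolding cb by (auto simp: k_def)
        moreover have "?r (x, y) < \<delta>" using y(1) \<delta>'(1) \<open>\<delta> > 0\<close> by auto
        ultimately show "\<exists>i. i \<in> K \<and> x \<in> cball (?c i) (?r i) \<and> ?r i < \<delta>" by blast
      qed
      \<comment> \<open>It suffices to bound finite subfamilies: the bound passes to the countable
        union.\<close>
      have fin: "measure lebesgue (\<Union>i\<in>C'. k i) \<le> \<eta>" if C': "C' \<subseteq> C" "finite C'" for C'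
      proof -
        have disk: "k i \<inter> k j = {}" if "i \<in> C'" "j \<in> C'" "i \<noteq> j" for i j
          using dis that C' unfolding cb pairwise_def disjnt_def by blast
        have kne: "k i \<noteq> {}" "fst i \<in> k i" for i by (cases i; auto simp: k_def)+
        have inj: "inj_on (\<lambda>i. (fst i, k i)) C'"
          \<comment> \<open>Disjoint nonempty intervals are distinct, so the sum over the tagged
            division is a sum over \<open>C'\<close>.\<close>
          by (rule inj_onI) (metis Int_absorb disk kne(1) prod.inject)
        define p where "p = (\<lambda>i. (fst i, k i)) ` C'"
        have kab: "k i \<subseteq> {a..b}" if "i \<in> C'" for i
        proof -
          have "i \<in> K" using that C' C by auto
          then show ?thesis by (cases i) (auto simp: K_def k_def Bad_def)
        qed
        have "p tagged_partial_division_of cbox a b"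
          unfolding tagged_partial_division_of_def
        proof (intro conjI allI impI)
          show "finite p" using C' by (simp add: p_def)
          fix x L assume "(x, L) \<in> p"
          then obtain i where i: "i \<in> C'" "x = fst i" "L = k i" by (auto simp: p_def)
          show "x \<in> L" using i kne by auto
          show "L \<subseteq> cbox a b" using i kab by auto
          show "\<exists>a b. L = cbox a b" using i by (cases i) (auto simp: k_def)
        next
          fix x L x' L' assume "(x, L) \<in> p \<and> (x', L') \<in> p \<and> (x, L) \<noteq> (x', L')"
          then obtain i j where i: "i \<in> C'" "x = fst i" "L = k i"
            and j: "j \<in> C'" "x' = fst j" "L' = k j" and "i \<noteq> j" by (auto simp: p_def)
          then have "L \<inter> L' = {}" using disk by auto
          then show "interior L \<inter> interior L' = {}"
            by (metis interior_Int interior_empty)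
        qed
        moreover have "d fine p"
        proof (rule fineI)
          fix x L assume "(x, L) \<in> p"
          then obtain i where i: "i \<in> C'" "x = fst i" "L = k i" by (auto simp: p_def)
          then have "i \<in> K" using C' C by auto
          then show "L \<subseteq> d x" using i by (auto simp: K_def)
        qed
        ultimately have "sum (\<lambda>(x,k). norm (measure lborel k *\<^sub>R w x - integral k w)) p < e * \<eta>"
          by (rule dp)
        then have s: "(\<Sum>i\<in>C'. norm (measure lborel (k i) *\<^sub>R w (fst i) - integral (k i) w)) < e * \<eta>"
          unfolding p_def by (subst (asm) sum.reindex[OF inj]) (simp add: o_def)
        \<comment> \<open>Up to sign, \<open>F y - F x\<close> is the integral over the interval.
          The defect that makes \<open>x\<close> bad is thus the Henstock error of that interval,
          and summing gives e times the total length < e * \<eta>.\<close>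
        have le: "e * measure lborel (k i) \<le> norm (measure lborel (k i) *\<^sub>R w (fst i) - integral (k i) w)"
          if i: "i \<in> C'" for i
        proof (cases i)
          case (Pair x y)
          then have "(x, y) \<in> K" using i C' C by auto
          then have xy: "a < x" "x < b" "a < y" "y < b"
            and big: "norm (F y - F x - (y - x) *\<^sub>R w x) > e * \<bar>y - x\<bar>"
            by (auto simp: K_def Bad_def)
          have comb: "integral {a..v} w = integral {a..u} w + integral {u..v} w"
            if "a < u" "u \<le> v" "v < b" for u v
            using that by (metis (no_types, lifting) Henstock_Kurzweil_Integration.integral_combine
                atLeastatMost_subset_iff integrable_on_subinterval less_eq_real_def w)
          show ?thesis
          proof (cases "x \<le> y")
            case True
            then have "F y - F x = integral {x..y} w" using comb[of x y] xy by (simp add: F_def)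
            then show ?thesis using big True by (simp add: Pair k_def norm_minus_commute)
          next
            case False
            then have "F x - F y = integral {y..x} w" using comb[of y x] xy by (simp add: F_def)
            then have "F y - F x - (y - x) *\<^sub>R w x = (x - y) *\<^sub>R w x - integral {y..x} w"
              by (simp add: algebra_simps)
            then show ?thesis using big False by (simp add: Pair k_def)
          qed
        qed
        have "(\<Sum>i\<in>C'. e * measure lborel (k i)) < e * \<eta>"
          by (rule le_less_trans[OF sum_mono s]) (rule le)
        then have "(\<Sum>i\<in>C'. measure lborel (k i)) < \<eta>"
          using \<open>e > 0\<close> by (simp add: sum_distrib_left[symmetric])
        moreover have "measure lebesgue (\<Union>i\<in>C'. k i) \<le> (\<Sum>i\<in>C'. measure lebesgue (k i))"
          by (rule measure_UNION_le) (use C' in \<open>auto simp: k_def\<close>)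
        moreover have "measure lebesgue (k i) = measure lborel (k i)" for i
          by (cases i) (simp add: k_def measure_completion)
        ultimately show ?thesis by simp
      qed
      let ?T = "(Bad n - (\<Union>i\<in>C. k i)) \<union> (\<Union>i\<in>C. k i)"
      have neg': "negligible (Bad n - (\<Union>i\<in>C. k i))" using neg unfolding cb .
      have km: "k i \<in> lmeasurable" for i by (cases i) (simp add: k_def)
      have U: "(\<Union>i\<in>C. k i) \<in> lmeasurable" "measure lebesgue (\<Union>i\<in>C. k i) \<le> \<eta>"
        using fmeasurable_UN_bound[OF C(1) km fin] measure_UN_bound[OF C(1) km fin] by auto
      have "measure lebesgue ?T \<le> \<eta>"
        using measure_Un_le[of "Bad n - (\<Union>i\<in>C. k i)" lebesgue "\<Union>i\<in>C. k i"] U neg'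
        by (simp add: negligible_imp_measure0 negligible_imp_sets fmeasurableD)
      moreover have "?T \<in> lmeasurable"
        using U neg' negligible_imp_measurable by (intro fmeasurable.Un) auto
      ultimately show "\<exists>T. Bad n \<subseteq> T \<and> T \<in> lmeasurable \<and> measure lebesgue T \<le> \<eta>"
        by (intro exI[of _ ?T]) auto
    qed
  qed
  then have "negligible (\<Union>n. Bad n)" by (intro negligible_Union_nat) auto
  then show ?thesis using sub unfolding F_def by (rule negligible_subset)
qed

lemma AE_lebesgue_on_01: "(AE t in lebesgue_on {0..1::real}. P t) \<longleftrightarrow> negligible {t\<in>{0..1}. \<not> P t}"
proof -
  have "(AE t in lebesgue_on {0..1::real}. P t) \<longleftrightarrow> (AE t in lebesgue. t \<in> {0..1} \<longrightarrow> P t)"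
    by (rule AE_restrict_space_iff) simp
  also have "\<dots> \<longleftrightarrow> negligible {t\<in>{0..1}. \<not> P t}"
  proof
    assume "AE t in lebesgue. t \<in> {0..1} \<longrightarrow> P t"
    then obtain N where N: "\<And>t. t \<in> space lebesgue - N \<Longrightarrow> t \<in> {0..1} \<longrightarrow> P t" "N \<in> null_sets lebesgue"
      by (rule AE_E3) (rule that)
    show "negligible {t\<in>{0..1}. \<not> P t}"
    proof (rule negligible_subset)
      show "negligible N" using N(2) by (simp only: negligible_iff_null_sets)
      show "{t\<in>{0..1}. \<not> P t} \<subseteq> N" using N(1) by (simp only: space_completion space_lborel space_borel) blast
    qed
  next
    assume "negligible {t\<in>{0..1}. \<not> P t}"
    then have "{t\<in>{0..1}. \<not> P t} \<in> null_sets lebesgue" by (simp only: negligible_iff_null_sets)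
    then show "AE t in lebesgue. t \<in> {0..1} \<longrightarrow> P t" by (rule AE_I') blast
  qed
  finally show ?thesis .
qed

lemma negligible_preimage_scale:
  fixes B :: "real set"
  assumes "negligible B" "r \<noteq> 0"
  shows "negligible {s. r * s \<in> B}"
proof -
  have "{s. r * s \<in> B} = (\<lambda>t. inverse r * t) ` B"
    using assms(2) by (auto simp: image_iff field_simps)
  moreover have "negligible ((\<lambda>t. inverse r * t) ` B)"
    using assms(1)
    by (intro negligible_differentiable_image_negligible) (auto intro!: derivative_intros)
  ultimately show ?thesis by simp
qed

section \<open>Extension and rescaling of H1 functions\<close>

lemma H1_on_zero: assumes "\<And>t. t \<in> {a..b} \<Longrightarrow> f t = 0" "a \<le> b" shows "H1_on a b f"
  unfolding H1_on_def using assms by (intro exI[of _ "\<lambda>_. 0"]) auto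

lemma H1_on_extend_zero:
  assumes f: "H1_on a m f" and m: "a \<le> m" "m \<le> b" and zero: "\<And>t. t \<in> {m..b} \<Longrightarrow> f t = 0"
  shows "H1_on a b f"
proof -
  obtain w where w: "w absolutely_integrable_on {a..m}" "(\<lambda>t. (norm (w t))\<^sup>2) integrable_on {a..m}"
    "\<And>t. t \<in> {a..m} \<Longrightarrow> f t = f a + integral {a..t} w"
    using f unfolding H1_on_def by blast
  define w' where "w' = (\<lambda>t. if t \<in> {a..m} then w t else 0)"
  have restr: "(\<lambda>t. if t \<in> {a..m} then k t else 0) integrable_on {a..b}" if "k integrable_on {a..m}"
    for k :: "real \<Rightarrow> 'c::banach"
  proof -
    have "{a..m} \<inter> {a..b} = {a..m}" using m by auto
    then show ?thesis using that by (simp only: integrable_restrict_Int)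
  qed
  have 1: "w' integrable_on {a..b}"
    unfolding w'_def using restr w(1) by (auto simp: absolutely_integrable_on_def)
  have "(\<lambda>t. norm (w' t)) = (\<lambda>t. if t \<in> {a..m} then norm (w t) else 0)" by (auto simp: w'_def)
  then have 2: "(\<lambda>t. norm (w' t)) integrable_on {a..b}"
    using restr[of "\<lambda>t. norm (w t)"] w(1) by (auto simp: absolutely_integrable_on_def)
  have "(\<lambda>t. (norm (w' t))\<^sup>2) = (\<lambda>t. if t \<in> {a..m} then (norm (w t))\<^sup>2 else 0)" by (auto simp: w'_def)
  then have 3: "(\<lambda>t. (norm (w' t))\<^sup>2) integrable_on {a..b}" using restr[OF w(2)] by simp
  have "f t = f a + integral {a..t} w'" if t: "t \<in> {a..b}" for t
  proof -
    have i: "integral {a..t} w' = integral ({a..m} \<inter> {a..t}) w"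
      unfolding w'_def by (rule integral_restrict_Int)
    show ?thesis
    proof (cases "t \<le> m")
      case True
      then have "{a..m} \<inter> {a..t} = {a..t}" by auto
      then show ?thesis using w(3)[of t] i t True by simp
    next
      \<comment> \<open>Since \<open>f m = 0\<close>, the integral of \<open>w\<close> over
        \<open>{a..m}\<close> is \<open>- f a\<close>, so the integral formula gives the value 0 at
        every later \<open>t\<close>.\<close>
      case False
      then have "{a..m} \<inter> {a..t} = {a..m}" by auto
      then show ?thesis using w(3)[of m] zero[of m] zero[of t] i t False m by simp
    qed
  qed
  then show ?thesis unfolding H1_on_def absolutely_integrable_on_def using 1 2 3 by blast
qed

lemma image_divide_interval: "r > 0 \<Longrightarrow> (\<lambda>x. x / r) ` {r * a..r * b} = {a..b::real}"
  by (auto simp: image_iff field_simps intro!: bexI[of _ "r * _"])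

lemma H1_on_rescale:
  assumes f: "H1_on (r * a) (r * b) f" and r: "r > 0"
  shows "H1_on a b (\<lambda>s. f (r * s))"
proof -
  obtain w where w: "w absolutely_integrable_on {r * a..r * b}"
    "(\<lambda>t. (norm (w t))\<^sup>2) integrable_on {r * a..r * b}"
    "\<And>t. t \<in> {r * a..r * b} \<Longrightarrow> f t = f (r * a) + integral {r * a..t} w"
    using f unfolding H1_on_def by blast
  have st: "(\<lambda>s. k (r * s)) integrable_on {a..b}" if "k integrable_on {r * a..r * b}"
    for k :: "real \<Rightarrow> 'c::real_normed_vector"
    using integrable_stretch_real[OF that, of r] r by (simp add: image_divide_interval)
  have wi: "w integrable_on {r * a..r * b}" "(\<lambda>t. norm (w t)) integrable_on {r * a..r * b}"
    using w(1) by (auto simp: absolutely_integrable_on_def)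
  define w' where "w' = (\<lambda>s. r *\<^sub>R w (r * s))"
  have 1: "w' integrable_on {a..b}" unfolding w'_def by (intro integrable_cmul st wi)
  have 2: "(\<lambda>s. norm (w' s)) integrable_on {a..b}"
    unfolding w'_def norm_scaleR using st[OF wi(2)] by (intro integrable_on_mult_right)
  have 3: "(\<lambda>s. (norm (w' s))\<^sup>2) integrable_on {a..b}"
    unfolding w'_def norm_scaleR power_mult_distrib using st[OF w(2)] by (intro integrable_on_mult_right)
  have "f (r * t) = f (r * a) + integral {a..t} w'" if t: "t \<in> {a..b}" for t
  proof -
    have "w integrable_on {r * a..r * t}"
      by (rule integrable_subinterval_real[OF wi(1)]) (use t r in \<open>simp add: mult_left_mono\<close>)
    from has_integral_stretch_real[OF integrable_integral[OF this], of r]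
    have "((\<lambda>s. w (r * s)) has_integral (1 / r) *\<^sub>R integral {r * a..r * t} w) {a..t}"
      using r by (simp add: image_divide_interval)
    from has_integral_cmul[OF this, of r]
    have "(w' has_integral integral {r * a..r * t} w) {a..t}" using r by (simp add: w'_def)
    then have "integral {a..t} w' = integral {r * a..r * t} w" by (rule integral_unique)
    then show ?thesis using w(3)[of "r * t"] t r by simp
  qed
  then show ?thesis unfolding H1_on_def absolutely_integrable_on_def using 1 2 3 by blast
qed

lemma H1_on_differentiable:
  assumes "H1_on a b f"
  shows "negligible {t\<in>{a<..<b}. \<not> f differentiable (at t)}"
proof -
  obtain w where w: "w absolutely_integrable_on {a..b}" "\<And>t. t \<in> {a..b} \<Longrightarrow> f t = f a + integral {a..t} w"
    using assms unfolding H1_on_def by blast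
  have "f differentiable (at t)"
    if t: "t \<in> {a<..<b}" and d: "((\<lambda>t. integral {a..t} w) has_vector_derivative w t) (at t)" for t
  proof -
    have "((\<lambda>s. f a + integral {a..s} w) has_derivative (\<lambda>h. 0 + h *\<^sub>R w t)) (at t)"
      by (rule has_derivative_add[OF has_derivative_const d[unfolded has_vector_derivative_def]])
    moreover have "\<forall>\<^sub>F s in nhds t. f a + integral {a..s} w = f s"
      by (rule eventually_mono[OF eventually_nhds_in_open[OF _ t]]) (simp, rule w(2)[symmetric], simp)
    ultimately have "(f has_derivative (\<lambda>h. 0 + h *\<^sub>R w t)) (at t)" by (rule has_derivative_transform_nhds)
    then show ?thesis by (rule differentiableI)
  qed
  then have "{t\<in>{a<..<b}. \<not> f differentiable (at t)} \<subseteq>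
     {t\<in>{a<..<b}. \<not> ((\<lambda>t. integral {a..t} w) has_vector_derivative w t) (at t)}" by blast
  moreover have "w integrable_on {a..b}" using w(1) by (simp add: absolutely_integrable_on_def)
  ultimately show ?thesis by (intro negligible_subset[OF negligible_not_differentiable_integral])
qed

lemma almost_everywhere_value_unique:
  assumes "negligible {t\<in>{0..1::real}. f t \<noteq> k}" "negligible {t\<in>{0..1}. f t \<noteq> k'}"
  shows "k = k'"
proof (rule ccontr)
  assume "k \<noteq> k'"
  then have "{0..1::real} \<subseteq> {t\<in>{0..1}. f t \<noteq> k} \<union> {t\<in>{0..1}. f t \<noteq> k'}" by auto
  then have "negligible {0..1::real}" by (rule negligible_subset[OF negligible_Un[OF assms]])
  then show False using negligible_interval(1)[of "0::real" 1] by simp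
qed

subsection \<open>Christoffel symbols and curvature in coordinates\<close>

text \<open>This and the next two definitions depend on the coordinate expression \<open>G\<close>
  alone, not on an atlas, so that two charts can be compared. \<open>christoffel_eq\<close> and
  \<open>curvature_eq\<close> identify them with the connection and curvature of the
  manifold.\<close>

definition koszul :: "('e::euclidean_space \<Rightarrow> 'e \<Rightarrow> 'e \<Rightarrow> real) \<Rightarrow> 'e \<Rightarrow> 'e \<Rightarrow> 'e \<Rightarrow> 'e \<Rightarrow> real" where
  "koszul G x u v w = FD (\<lambda>y. G y v w) x u + FD (\<lambda>y. G y u w) x v - FD (\<lambda>y. G y u v) x w"

definition levi_civita :: "('e::euclidean_space \<Rightarrow> 'e \<Rightarrow> 'e \<Rightarrow> real) \<Rightarrow> 'e \<Rightarrow> 'e \<Rightarrow> 'e \<Rightarrow> 'e" where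
  "levi_civita G x u v = (THE z. \<forall>w. 2 * G x z w = koszul G x u v w)"

text \<open>For coordinate-constant fields the bracket vanishes and the covariant derivative of
  \<open>w\<close> along \<open>v\<close> is \<open>levi_civita G y v w\<close>; the general
  definition of curvature then reduces to this expression.\<close>

definition riemann :: "('e::euclidean_space \<Rightarrow> 'e \<Rightarrow> 'e \<Rightarrow> real) \<Rightarrow> 'e \<Rightarrow> 'e \<Rightarrow> 'e \<Rightarrow> 'e \<Rightarrow> 'e" where
  "riemann G x u v w =
     FD (\<lambda>y. levi_civita G y v w) x u - FD (\<lambda>y. levi_civita G y u w) x v
     + levi_civita G x u (levi_civita G x v w) - levi_civita G x v (levi_civita G x u w)"

locale coordinate_metric =
  fixes U :: "'e::euclidean_space set" and G :: "'e \<Rightarrow> 'e \<Rightarrow> 'e \<Rightarrow> real"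
  assumes open_U: "open U"
    and bilin: "x \<in> U \<Longrightarrow> bilinear (G x)"
    and sym: "x \<in> U \<Longrightarrow> G x u v = G x v u"
    and nondeg: "x \<in> U \<Longrightarrow> (\<And>v. G x u v = 0) \<Longrightarrow> u = 0"
    and smooth: "smooth_on U (\<lambda>x. G x u v)"
begin

abbreviation \<Gamma> :: "'e \<Rightarrow> 'e \<Rightarrow> 'e \<Rightarrow> 'e" where "\<Gamma> \<equiv> levi_civita G"

lemma eventually_U: "x \<in> U \<Longrightarrow> \<forall>\<^sub>F y in nhds x. y \<in> U"
  using open_U by (rule eventually_nhds_in_open)

lemma G_deriv: "x \<in> U \<Longrightarrow> ((\<lambda>y. G y a b) has_derivative FD (\<lambda>y. G y a b) x) (at x)"
  using smooth by (rule smooth_on_imp_has_derivative)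

lemma G_differentiable: "x \<in> U \<Longrightarrow> (\<lambda>y. G y a b) differentiable (at x)"
  using G_deriv differentiable_def by blast

lemma linear_G_left: "x \<in> U \<Longrightarrow> linear (\<lambda>a. G x a b)"
  and linear_G_right: "x \<in> U \<Longrightarrow> linear (G x a)"
  using bilin by (auto simp: bilinear_def)

lemma linear_FD_G:
  assumes "x \<in> U"
  shows "linear (\<lambda>a. FD (\<lambda>y. G y a b) x h)" "linear (\<lambda>b. FD (\<lambda>y. G y a b) x h)"
    "linear (FD (\<lambda>y. G y a b) x)"
proof -
  show "linear (\<lambda>a. FD (\<lambda>y. G y a b) x h)"
    by (rule linear_FD_parameter[OF eventually_mono[OF eventually_U[OF assms]]])
       (auto intro: linear_G_left G_differentiable assms)
  show "linear (\<lambda>b. FD (\<lambda>y. G y a b) x h)"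
    by (rule linear_FD_parameter[OF eventually_mono[OF eventually_U[OF assms]]])
       (auto intro: linear_G_right G_differentiable assms)
  show "linear (FD (\<lambda>y. G y a b) x)" using G_deriv[OF assms] by (rule has_derivative_linear)
qed

lemma linear_koszul:
  assumes "x \<in> U"
  shows "linear (\<lambda>u. koszul G x u v w)" "linear (\<lambda>v. koszul G x u v w)" "linear (koszul G x u v)"
  unfolding koszul_def using linear_FD_G[OF assms]
  by (auto intro!: linear_compose_add linear_compose_sub)

text \<open>The Gram matrix of \<open>G x\<close> as an endomorphism of the model space. It turns
  the equation defining the Christoffel symbols into a linear system.\<close>

definition gram :: "'e \<Rightarrow> 'e \<Rightarrow> 'e" where
  "gram x z = (\<Sum>i\<in>Basis. G x z i *\<^sub>R i)"

lemma gram_inner: "i \<in> Basis \<Longrightarrow> gram x z \<bullet> i = G x z i"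
  by (simp add: gram_def inner_sum_left inner_Basis if_distrib cong: if_cong)

lemma linear_gram: assumes "x \<in> U" shows "linear (gram x)"
proof (rule linearI)
  show "gram x (a + b) = gram x a + gram x b" for a b
    by (rule euclidean_eqI) (simp add: gram_inner inner_add_left linear_add[OF linear_G_left[OF assms]])
  show "gram x (r *\<^sub>R a) = r *\<^sub>R gram x a" for r a
    by (rule euclidean_eqI) (simp add: gram_inner linear_scale[OF linear_G_left[OF assms]])
qed

lemma G_determined:
  assumes "x \<in> U" "linear k" "\<And>i. i \<in> Basis \<Longrightarrow> G x z i = k i"
  shows "G x z w = k w"
  using linear_eq_on_span[OF linear_G_right[OF assms(1)] assms(2), of Basis z w] assms(3)
  by (simp add: span_Basis)

lemma inj_gram: assumes "x \<in> U" shows "inj (gram x)"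
proof -
  have "z = 0" if "gram x z = 0" for z
  proof (rule nondeg[OF assms])
    show "G x z v = 0" for v
      by (rule G_determined[OF assms, of "\<lambda>_. 0"])
         (use that gram_inner[of _ x z] in \<open>auto simp: linear_zero\<close>)
  qed
  then show ?thesis by (simp add: linear_injective_0[OF linear_gram[OF assms]])
qed

text \<open>Nondegeneracy makes \<open>gram x\<close> injective, hence surjective in finite
  dimension. This legitimates the definite description in \<open>levi_civita\<close>.\<close>

lemma riesz:
  assumes x: "x \<in> U" and k: "linear k"
  shows "\<exists>!z. \<forall>w. G x z w = k w"
proof (rule ex_ex1I)
  have "surj (gram x)"
    by (rule linear_injective_imp_surjective[OF linear_gram[OF x] inj_gram[OF x]]) simp
  then obtain z where z: "gram x z = (\<Sum>i\<in>Basis. k i *\<^sub>R i)" by (metis surjD)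
  have "G x z i = k i" if "i \<in> Basis" for i
    using gram_inner[OF that, of x z] that
    by (simp add: z inner_sum_left inner_Basis if_distrib cong: if_cong)
  then show "\<exists>z. \<forall>w. G x z w = k w" using G_determined[OF x k] by blast
next
  fix z z' assume "\<forall>w. G x z w = k w" "\<forall>w. G x z' w = k w"
  then have "G x (z - z') w = 0" for w by (simp add: linear_diff[OF linear_G_left[OF x]])
  then show "z = z'" using nondeg[OF x] by fastforce
qed

lemma G_cancel: assumes "x \<in> U" "\<And>w. G x a w = G x b w" shows "a = b"
  using riesz[OF assms(1) linear_G_right[OF assms(1), of b]] assms(2) by blast

lemma levi_civita_eq: assumes x: "x \<in> U" shows "2 * G x (\<Gamma> x u v) w = koszul G x u v w"
proof -
  have "linear (\<lambda>w. koszul G x u v w / 2)"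
    using linear_compose_scale_right[OF linear_koszul(3)[OF x], of "1/2"] by simp
  from riesz[OF x this] have "\<exists>!z. \<forall>w. 2 * G x z w = koszul G x u v w"
    by (simp add: field_simps)
  from theI'[OF this] show ?thesis by (simp add: levi_civita_def)
qed

lemma levi_civita_eqI:
  assumes x: "x \<in> U" and "\<And>w. 2 * G x z w = koszul G x u v w"
  shows "\<Gamma> x u v = z"
  by (rule G_cancel[OF x]) (metis assms levi_civita_eq mult_cancel_left zero_neq_numeral)

lemma bilinear_levi_civita: assumes x: "x \<in> U" shows "bilinear (\<Gamma> x)"
  unfolding bilinear_def
proof (intro conjI allI linearI)
  note G = linear_add[OF linear_G_left[OF x]] linear_scale[OF linear_G_left[OF x]]
  note K = linear_add[OF linear_koszul(1)[OF x]] linear_scale[OF linear_koszul(1)[OF x]]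
     linear_add[OF linear_koszul(2)[OF x]] linear_scale[OF linear_koszul(2)[OF x]]
  show "\<Gamma> x u (v + v') = \<Gamma> x u v + \<Gamma> x u v'" "\<Gamma> x (u + u') v = \<Gamma> x u v + \<Gamma> x u' v" for u u' v v'
    by (rule levi_civita_eqI[OF x], simp add: G K levi_civita_eq[OF x] distrib_left)+
  show "\<Gamma> x u (r *\<^sub>R v) = r *\<^sub>R \<Gamma> x u v" "\<Gamma> x (r *\<^sub>R u) v = r *\<^sub>R \<Gamma> x u v" for u v r
    by (rule levi_civita_eqI[OF x], simp add: G K levi_civita_eq[OF x, of u v, symmetric])+
qed

text \<open>The matrix \<open>gram\<close> and the Koszul right-hand side are differentiable because
  the metric is smooth. One derivative of the symbols is what curvature asks for.\<close>

lemma differentiable_levi_civita: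
  assumes x: "x \<in> U" shows "(\<lambda>y. \<Gamma> y u v) differentiable (at x)"
proof (rule differentiable_solution_linear_system[where B = gram
      and \<rho> = "\<lambda>y. \<Sum>i\<in>Basis. (koszul G y u v i / 2) *\<^sub>R i"])
  show "\<forall>\<^sub>F y in nhds x. linear (gram y)"
    using eventually_U[OF x] by eventually_elim (rule linear_gram)
  show "inj (gram x)" using x by (rule inj_gram)
  show "(\<lambda>y. gram y a) differentiable (at x)" for a
    using has_derivative_sum[OF has_derivative_scaleR_left[OF G_deriv[OF x]], of "\<lambda>_. a" "\<lambda>i. i" "\<lambda>i. i" Basis]
    by (auto simp: gram_def differentiable_def)
  have "(\<lambda>y. FD (\<lambda>y. G y a b) y c) differentiable (at x)" for a b c
    using smooth_on_imp_has_derivative[OF smooth_on_FD[OF smooth] x] by (auto simp: differentiable_def)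
  then show "(\<lambda>y. \<Sum>i\<in>Basis. (koszul G y u v i / 2) *\<^sub>R i) differentiable (at x)"
    unfolding koszul_def divide_inverse by (intro derivative_intros) auto
  show "\<forall>\<^sub>F y in nhds x. gram y (\<Gamma> y u v) = (\<Sum>i\<in>Basis. (koszul G y u v i / 2) *\<^sub>R i)"
    using eventually_U[OF x]
    by eventually_elim (simp add: gram_def levi_civita_eq[symmetric])
qed

lemma levi_civita_deriv:
  "x \<in> U \<Longrightarrow> ((\<lambda>y. \<Gamma> y u v) has_derivative FD (\<lambda>y. \<Gamma> y u v) x) (at x)"
  using differentiable_levi_civita frechet_derivative_works by blast

text \<open>The scaled slots are those occupied by the velocity in the index form. Each of the four
  terms is homogeneous of degree one in \<open>u\<close> and in \<open>w\<close>.\<close>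

lemma riemann_scale:
  assumes x: "x \<in> U"
  shows "riemann G x (r *\<^sub>R u) v (r *\<^sub>R w) = (r * r) *\<^sub>R riemann G x u v w"
proof -
  note B = bilinear_levi_civita[OF x]
  note sc = bilinear_lmul[OF B] bilinear_rmul[OF B]
  have l1: "linear (\<lambda>a. FD (\<lambda>y. \<Gamma> y a b) x h)" for b h
    by (rule linear_FD_parameter[OF eventually_mono[OF eventually_U[OF x]] differentiable_levi_civita[OF x]])
       (use bilinear_levi_civita in \<open>simp add: bilinear_def\<close>)
  have l2: "linear (\<lambda>b. FD (\<lambda>y. \<Gamma> y a b) x h)" for a h
    by (rule linear_FD_parameter[OF eventually_mono[OF eventually_U[OF x]] differentiable_levi_civita[OF x]])
       (use bilinear_levi_civita in \<open>simp add: bilinear_def\<close>)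
  have l3: "linear (FD (\<lambda>y. \<Gamma> y a b) x)" for a b
    using levi_civita_deriv[OF x] by (rule has_derivative_linear)
  show ?thesis
    by (simp add: riemann_def sc linear_scale[OF l1] linear_scale[OF l2] linear_scale[OF l3]
        scaleR_add_right scaleR_diff_right)
qed

end

section \<open>Transformation laws under coordinate changes\<close>

locale coordinate_change =
  src: coordinate_metric U G + tgt: coordinate_metric U' G'
  for U U' :: "'e::euclidean_space set" and G G' :: "'e \<Rightarrow> 'e \<Rightarrow> 'e \<Rightarrow> real" +
  fixes O' :: "'e set" and \<phi> :: "'e \<Rightarrow> 'e"
  assumes open_O: "open O'" and O_sub: "O' \<subseteq> U" and \<phi>_in: "x \<in> O' \<Longrightarrow> \<phi> x \<in> U'"
    and smooth_\<phi>: "smooth_on O' \<phi>"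
    and surj_\<phi>: "x \<in> O' \<Longrightarrow> surj (FD \<phi> x)"
    and isometry: "x \<in> O' \<Longrightarrow> G x u v = G' (\<phi> x) (FD \<phi> x u) (FD \<phi> x v)"
begin

abbreviation D2 :: "'e \<Rightarrow> 'e \<Rightarrow> 'e \<Rightarrow> 'e" where "D2 x v u \<equiv> FD (\<lambda>y. FD \<phi> y v) x u"

lemma eventually_O: "x \<in> O' \<Longrightarrow> \<forall>\<^sub>F y in nhds x. y \<in> O'"
  using open_O by (rule eventually_nhds_in_open)

lemma \<phi>_deriv: "x \<in> O' \<Longrightarrow> (\<phi> has_derivative FD \<phi> x) (at x)"
  and D\<phi>_deriv: "x \<in> O' \<Longrightarrow> ((\<lambda>y. FD \<phi> y v) has_derivative D2 x v) (at x)"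
  and D2\<phi>_deriv: "x \<in> O' \<Longrightarrow> ((\<lambda>y. D2 y v u) has_derivative FD (\<lambda>y. D2 y v u) x) (at x)"
  using smooth_\<phi> by (auto intro!: smooth_on_imp_has_derivative smooth_on_FD)

lemma D2_commute: "x \<in> O' \<Longrightarrow> D2 x u v = D2 x v u"
  using FD_FD_commute[OF open_O _ smooth_\<phi>] .

text \<open>Needed for two bilinear families: the target metric, where it differentiates the
  isometry, and the target Christoffel symbols, where it differentiates their transformation
  law.\<close>

lemma has_derivative_pullback:
  assumes x: "x \<in> O'"
    and bil: "\<And>y. y \<in> U' \<Longrightarrow> bilinear (F y)"
    and der: "\<And>a b. ((\<lambda>y. F y a b) has_derivative F' a b) (at (\<phi> x))"
  shows "((\<lambda>y. F (\<phi> y) (FD \<phi> y a) (FD \<phi> y b)) has_derivative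
    (\<lambda>h. F' (FD \<phi> x a) (FD \<phi> x b) (FD \<phi> x h)
      + F (\<phi> x) (D2 x a h) (FD \<phi> x b) + F (\<phi> x) (FD \<phi> x a) (D2 x b h))) (at x)"
proof (rule has_derivative_apply2[where F = "\<lambda>y. F (\<phi> y)" and F' = "\<lambda>a b h. F' a b (FD \<phi> x h)"])
  show "\<forall>\<^sub>F y in nhds x. bilinear (F (\<phi> y))"
    using eventually_O[OF x] by eventually_elim (intro bil \<phi>_in)
  show "((\<lambda>y. F (\<phi> y) a b) has_derivative (\<lambda>h. F' a b (FD \<phi> x h))) (at x)" for a b
    using has_derivative_compose[OF \<phi>_deriv[OF x] der] .
qed (intro D\<phi>_deriv x)+

lemma FD_isometry:
  assumes x: "x \<in> O'"
  shows "FD (\<lambda>y. G y a b) x h = FD (\<lambda>y. G' y (FD \<phi> x a) (FD \<phi> x b)) (\<phi> x) (FD \<phi> x h)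
      + G' (\<phi> x) (D2 x a h) (FD \<phi> x b) + G' (\<phi> x) (FD \<phi> x a) (D2 x b h)"
proof -
  have "((\<lambda>y. G y a b) has_derivative (\<lambda>h. FD (\<lambda>y. G' y (FD \<phi> x a) (FD \<phi> x b)) (\<phi> x) (FD \<phi> x h)
      + G' (\<phi> x) (D2 x a h) (FD \<phi> x b) + G' (\<phi> x) (FD \<phi> x a) (D2 x b h))) (at x)"
    by (rule has_derivative_transform_nhds
        [OF has_derivative_pullback[OF x tgt.bilin tgt.G_deriv[OF \<phi>_in[OF x]]]])
       (assumption, rule eventually_mono[OF eventually_O[OF x]], simp add: isometry)
  then show ?thesis by (simp add: FD_eqI)
qed

text \<open>Differentiating the isometry produces six terms with second derivatives of \<phi>. In
  the Koszul combination four of them cancel in pairs by symmetry, and the other two add up to twice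
  the product of \<open>D2 x v u\<close> with the test vector.\<close>

lemma levi_civita_transform:
  assumes x: "x \<in> O'"
  shows "FD \<phi> x (src.\<Gamma> x u v) = tgt.\<Gamma> (\<phi> x) (FD \<phi> x u) (FD \<phi> x v) + D2 x v u"
proof (rule tgt.G_cancel[OF \<phi>_in[OF x]])
  fix w'
  \<comment> \<open>The isometry speaks only of vectors of the form \<open>FD \<phi> x w\<close>; by
    surjectivity of the differential these are all test vectors.\<close>
  obtain w where w: "w' = FD \<phi> x w" using surj_\<phi>[OF x] by (metis surjD)
  have xU: "x \<in> U" using x O_sub by blast
  note s = tgt.sym[OF \<phi>_in[OF x]]
  have "2 * G' (\<phi> x) (FD \<phi> x (src.\<Gamma> x u v)) w' = 2 * G x (src.\<Gamma> x u v) w"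
    by (simp add: w isometry[OF x])
  also have "\<dots> = koszul G x u v w" by (rule src.levi_civita_eq[OF xU])
  also have "\<dots> = koszul G' (\<phi> x) (FD \<phi> x u) (FD \<phi> x v) w' + 2 * G' (\<phi> x) (D2 x v u) w'"
    unfolding koszul_def FD_isometry[OF x] w
    using D2_commute[OF x, of u v] D2_commute[OF x, of u w] D2_commute[OF x, of v w]
      s[of "D2 x w u" "FD \<phi> x v"] s[of "D2 x w v" "FD \<phi> x u"]
    by simp
  also have "\<dots> = 2 * G' (\<phi> x) (tgt.\<Gamma> (\<phi> x) (FD \<phi> x u) (FD \<phi> x v) + D2 x v u) w'"
    by (simp add: tgt.levi_civita_eq[OF \<phi>_in[OF x], symmetric]
        linear_add[OF tgt.linear_G_left[OF \<phi>_in[OF x]]])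
  finally show "G' (\<phi> x) (FD \<phi> x (src.\<Gamma> x u v)) w'
    = G' (\<phi> x) (tgt.\<Gamma> (\<phi> x) (FD \<phi> x u) (FD \<phi> x v) + D2 x v u) w'" by simp
qed

text \<open>Both sides are the derivative along \<open>u\<close> of one function,
  \<open>FD \<phi> y (src.\<Gamma> y v w)\<close>: directly by the product rule, and after replacing
  it by the transformation law.\<close>

lemma FD_levi_civita_transform:
  assumes x: "x \<in> O'"
  shows "D2 x (src.\<Gamma> x v w) u + FD \<phi> x (FD (\<lambda>y. src.\<Gamma> y v w) x u) =
    FD (\<lambda>y. tgt.\<Gamma> y (FD \<phi> x v) (FD \<phi> x w)) (\<phi> x) (FD \<phi> x u)
    + tgt.\<Gamma> (\<phi> x) (D2 x v u) (FD \<phi> x w) + tgt.\<Gamma> (\<phi> x) (FD \<phi> x v) (D2 x w u)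
    + FD (\<lambda>y. D2 y w v) x u"
proof -
  have xU: "x \<in> U" using x O_sub by blast
  have lin: "\<forall>\<^sub>F y in nhds x. linear (FD \<phi> y)"
    using eventually_O[OF x] by eventually_elim (rule has_derivative_linear[OF \<phi>_deriv])
  have 1: "((\<lambda>y. FD \<phi> y (src.\<Gamma> y v w)) has_derivative
     (\<lambda>h. D2 x (src.\<Gamma> x v w) h + FD \<phi> x (FD (\<lambda>y. src.\<Gamma> y v w) x h))) (at x)"
    using lin D\<phi>_deriv[OF x] src.levi_civita_deriv[OF xU] by (rule has_derivative_apply)
  have 2: "((\<lambda>y. FD \<phi> y (src.\<Gamma> y v w)) has_derivative
     (\<lambda>h. FD (\<lambda>y. tgt.\<Gamma> y (FD \<phi> x v) (FD \<phi> x w)) (\<phi> x) (FD \<phi> x h)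
    + tgt.\<Gamma> (\<phi> x) (D2 x v h) (FD \<phi> x w) + tgt.\<Gamma> (\<phi> x) (FD \<phi> x v) (D2 x w h)
    + FD (\<lambda>y. D2 y w v) x h)) (at x)"
    by (rule has_derivative_transform_nhds[OF has_derivative_add
          [OF has_derivative_pullback[OF x tgt.bilinear_levi_civita tgt.levi_civita_deriv[OF \<phi>_in[OF x]]]
            D2\<phi>_deriv[OF x]]])
       (assumption, rule eventually_mono[OF eventually_O[OF x]], simp add: levi_civita_transform)
  show ?thesis using fun_cong[OF has_derivative_unique[OF 1 2], of u] .
qed

text \<open>Everything is rewritten in terms of the source symbols. Third derivatives of \<phi> are
  symmetric in \<open>u\<close> and \<open>v\<close> and drop out of the antisymmetrization; the
  second derivatives coming from differentiated symbols cancel those coming from products of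
  symbols.\<close>

lemma riemann_transform:
  assumes x: "x \<in> O'"
  shows "riemann G' (\<phi> x) (FD \<phi> x u) (FD \<phi> x v) (FD \<phi> x w) = FD \<phi> x (riemann G x u v w)"
proof -
  let ?P = "FD \<phi> x" and ?S = "src.\<Gamma> x" and ?T = "tgt.\<Gamma> (\<phi> x)"
  note B = tgt.bilinear_levi_civita[OF \<phi>_in[OF x]]
  have third: "FD (\<lambda>y. D2 y w v) x u = FD (\<lambda>y. D2 y w u) x v"
    by (rule FD_FD_commute[OF open_O x]) (intro smooth_on_FD smooth_\<phi>)
  have T: "?T (?P a) (?P b) = ?P (?S a b) - D2 x b a" for a b
    using levi_civita_transform[OF x, of a b] by simp
  have TT: "?T (?P a) (?T (?P b) (?P c)) = ?P (?S a (?S b c)) - D2 x (?S b c) a - ?T (?P a) (D2 x c b)"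
    for a b c by (simp add: T bilinear_rsub[OF B])
  have F: "FD (\<lambda>y. tgt.\<Gamma> y (?P b) (?P c)) (\<phi> x) (?P a) =
      D2 x (?S b c) a + ?P (FD (\<lambda>y. src.\<Gamma> y b c) x a)
      - ?T (D2 x b a) (?P c) - ?T (?P b) (D2 x c a) - FD (\<lambda>y. D2 y c b) x a" for a b c
    using FD_levi_civita_transform[OF x, of b c a] by (simp add: algebra_simps)
  have lin: "linear ?P" by (rule has_derivative_linear[OF \<phi>_deriv[OF x]])
  show ?thesis
    unfolding riemann_def F TT
    by (simp add: linear_add[OF lin] linear_diff[OF lin] third D2_commute[OF x, of u v])
qed

end

subsection \<open>Tangent vectors and covariant derivatives\<close>

abbreviation tr :: "('p, 'e) chart \<Rightarrow> ('p, 'e) chart \<Rightarrow> 'e \<Rightarrow> 'e" where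
  "tr c d \<equiv> cmap d \<circ> cinv c"

abbreviation jac :: "('p, 'e::euclidean_space) chart \<Rightarrow> ('p, 'e) chart \<Rightarrow> 'p \<Rightarrow> 'e \<Rightarrow> 'e" where
  "jac c d p \<equiv> FD (tr c d) (cmap c p)"

abbreviation overlap :: "('p, 'e) chart \<Rightarrow> ('p, 'e) chart \<Rightarrow> 'e set" where
  "overlap c d \<equiv> cmap c ` (cdom c \<inter> cdom d)"

locale lorentzian =
  fixes A :: "('p::{t2_space, second_countable_topology}, 'e::euclidean_space) chart set"
    and g :: "('p, 'e) metric"
  assumes atlas: "smooth_atlas A" and metric: "lorentzian_metric A g"
begin

abbreviation T :: "'p \<Rightarrow> ('p, 'e) tvec set" where "T \<equiv> tangent_space A"

section \<open>Charts and tangent spaces\<close>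

lemma chartD:
  assumes "c \<in> A"
  shows open_cdom: "open (cdom c)" and open_cimage: "open (cimage c)"
    and cinv_cmap: "\<And>p. p \<in> cdom c \<Longrightarrow> cinv c (cmap c p) = p"
    and continuous_on_cinv: "continuous_on (cimage c) (cinv c)"
proof -
  have *: "is_chart c" using assms atlas by (simp add: smooth_atlas_def)
  then show "open (cdom c)" "open (cimage c)" by (auto simp: is_chart_def)
  have "homeomorphism (cdom c) (cimage c) (cmap c) (cinv c)" using * by (simp add: is_chart_def)
  then show "continuous_on (cimage c) (cinv c)"
    "\<And>p. p \<in> cdom c \<Longrightarrow> cinv c (cmap c p) = p"
    unfolding homeomorphism_def by auto
qed

lemma tr_cmap: "c \<in> A \<Longrightarrow> p \<in> cdom c \<Longrightarrow> tr c d (cmap c p) = cmap d p"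
  by (simp add: cinv_cmap)

lemma open_overlap:
  assumes c: "c \<in> A" and d: "d \<in> A" shows "open (overlap c d)"
proof -
  have "overlap c d = cimage c \<inter> cinv c -` cdom d"
    using cinv_cmap[OF c] by auto
  then show ?thesis
    using continuous_open_preimage[OF continuous_on_cinv[OF c] open_cimage[OF c] open_cdom[OF d]] by simp
qed

lemma smooth_tr: "c \<in> A \<Longrightarrow> d \<in> A \<Longrightarrow> smooth_on (overlap c d) (tr c d)"
  using atlas unfolding smooth_atlas_def by blast

lemma tr_deriv:
  assumes "c \<in> A" "d \<in> A" "p \<in> cdom c" "p \<in> cdom d"
  shows "(tr c d has_derivative jac c d p) (at (cmap c p))"
  by (rule smooth_on_imp_has_derivative[OF smooth_tr]) (use assms in auto)

lemma linear_jac: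
  assumes "c \<in> A" "d \<in> A" "p \<in> cdom c" "p \<in> cdom d"
  shows "linear (jac c d p)"
  using tr_deriv[OF assms] by (rule has_derivative_linear)

lemma jac_jac:
  assumes c: "c \<in> A" "p \<in> cdom c" and d: "d \<in> A" "p \<in> cdom d" and e: "e \<in> A" "p \<in> cdom e"
  shows "jac d e p (jac c d p u) = jac c e p u"
proof -
  have "(tr d e has_derivative jac d e p) (at (tr c d (cmap c p)))"
    using tr_deriv[of d e p] d e by (simp only: tr_cmap[OF c])
  from has_derivative_compose[OF tr_deriv[of c d p] this]
  have "((\<lambda>x. tr d e (tr c d x)) has_derivative (\<lambda>u. jac d e p (jac c d p u))) (at (cmap c p))"
    using c d by simp
  moreover have "\<forall>\<^sub>F x in nhds (cmap c p). tr d e (tr c d x) = tr c e x"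
  proof (rule eventually_mono[OF eventually_nhds_in_open[OF open_overlap[OF c(1) d(1)]]])
    show "cmap c p \<in> overlap c d" using c d by blast
    show "tr d e (tr c d x) = tr c e x" if "x \<in> overlap c d" for x
      using that cinv_cmap c d by auto
  qed
  ultimately have "(tr c e has_derivative (\<lambda>u. jac d e p (jac c d p u))) (at (cmap c p))"
    by (rule has_derivative_transform_nhds)
  then show ?thesis by (simp add: FD_eqI)
qed

lemma jac_self:
  assumes c: "c \<in> A" "p \<in> cdom c" shows "jac c c p u = u"
proof -
  have "(tr c c has_derivative (\<lambda>u. u)) (at (cmap c p))"
  proof (rule has_derivative_transform_nhds[OF has_derivative_ident])
    show "\<forall>\<^sub>F x in nhds (cmap c p). x = tr c c x"
      by (rule eventually_mono[OF eventually_nhds_in_open[OF open_cimage[OF c(1)]]])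
         (use cinv_cmap[OF c(1)] c in auto)
  qed
  then show ?thesis by (simp add: FD_eqI)
qed

lemma tangent_spaceD:
  "v \<in> T p \<Longrightarrow> c \<in> A \<Longrightarrow> d \<in> A \<Longrightarrow> p \<in> cdom c \<Longrightarrow> p \<in> cdom d \<Longrightarrow> v d = jac c d p (v c)"
  "v \<in> T p \<Longrightarrow> c \<notin> A \<or> p \<notin> cdom c \<Longrightarrow> v c = 0"
  unfolding tangent_space_def by blast+

lemma chart_around: obtains c where "c \<in> A" "p \<in> cdom c"
  using atlas unfolding smooth_atlas_def by blast

lemma tangent_spaceI:
  assumes "\<And>c d. c \<in> A \<Longrightarrow> p \<in> cdom c \<Longrightarrow> d \<in> A \<Longrightarrow> p \<in> cdom d \<Longrightarrow> v d = jac c d p (v c)"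
    and "\<And>c. c \<notin> A \<or> p \<notin> cdom c \<Longrightarrow> v c = 0"
  shows "v \<in> T p"
  unfolding tangent_space_def using assms by blast

lemma subspace_T: "subspace (T p)"
  unfolding subspace_def
proof (intro conjI ballI allI)
  show "0 \<in> T p"
    by (rule tangent_spaceI) (simp_all only: zero_fun_apply linear_0[OF linear_jac])
  show "u + v \<in> T p" if "u \<in> T p" "v \<in> T p" for u v
  proof (rule tangent_spaceI)
    fix c d assume c: "c \<in> A" "p \<in> cdom c" "d \<in> A" "p \<in> cdom d"
    show "(u + v) d = jac c d p ((u + v) c)"
      unfolding plus_fun_apply linear_add[OF linear_jac[OF c(1,3,2,4)]]
      using tangent_spaceD(1)[OF that(1) c(1,3,2,4)] tangent_spaceD(1)[OF that(2) c(1,3,2,4)]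
      by (simp only:)
  qed (simp add: tangent_spaceD(2)[OF that(1)] tangent_spaceD(2)[OF that(2)])
  show "r *\<^sub>R u \<in> T p" if "u \<in> T p" for r u
  proof (rule tangent_spaceI)
    fix c d assume c: "c \<in> A" "p \<in> cdom c" "d \<in> A" "p \<in> cdom d"
    show "(r *\<^sub>R u) d = jac c d p ((r *\<^sub>R u) c)"
      unfolding scaleR_fun_def linear_scale[OF linear_jac[OF c(1,3,2,4)]]
      using tangent_spaceD(1)[OF that c(1,3,2,4)] by (simp only:)
  qed (simp add: scaleR_fun_def tangent_spaceD(2)[OF that])
qed

lemma coord_vec_in_T:
  assumes c: "c \<in> A" "p \<in> cdom c" shows "coord_vec A c p u \<in> T p"
  by (rule tangent_spaceI) (auto simp only: coord_vec_def jac_jac[OF c] if_True simp_thms split: if_split)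

lemma coord_vec_self: "c \<in> A \<Longrightarrow> p \<in> cdom c \<Longrightarrow> coord_vec A c p u c = u"
  by (simp only: coord_vec_def jac_self if_True simp_thms)

lemma coord_vec_coord:
  assumes "v \<in> T p" and c: "c \<in> A" "p \<in> cdom c" shows "coord_vec A c p (v c) = v"
proof
  show "coord_vec A c p (v c) d = v d" for d
    using tangent_spaceD(1)[OF assms(1) c(1) _ c(2), of d] tangent_spaceD(2)[OF assms(1), of d]
    unfolding coord_vec_def by presburger
qed

lemma coord_vec_jac:
  assumes c: "c \<in> A" "p \<in> cdom c" and d: "d \<in> A" "p \<in> cdom d"
  shows "coord_vec A d p (jac c d p u) = coord_vec A c p u"
  by (rule ext) (auto simp only: coord_vec_def jac_jac[OF c d] split: if_split)

lemma linear_coord_vec: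
  assumes c: "c \<in> A" "p \<in> cdom c" shows "linear (coord_vec A c p)"
proof (rule linearI)
  show "coord_vec A c p (u + v) = coord_vec A c p u + coord_vec A c p v" for u v
    by (rule ext) (auto simp only: coord_vec_def plus_fun_apply linear_add[OF linear_jac[OF c(1) _ c(2)]]
        add_0_left split: if_split)
  show "coord_vec A c p (r *\<^sub>R u) = r *\<^sub>R coord_vec A c p u" for r u
    by (rule ext) (auto simp only: coord_vec_def scaleR_fun_def linear_scale[OF linear_jac[OF c(1) _ c(2)]]
        scaleR_zero_right split: if_split)
qed

section \<open>The metric in charts\<close>

lemma g_sym: "u \<in> T p \<Longrightarrow> v \<in> T p \<Longrightarrow> g p u v = g p v u"
  and g_add_left: "u \<in> T p \<Longrightarrow> v \<in> T p \<Longrightarrow> w \<in> T p \<Longrightarrow> g p (u + v) w = g p u w + g p v w"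
  and g_scale_left: "u \<in> T p \<Longrightarrow> v \<in> T p \<Longrightarrow> g p (r *\<^sub>R u) v = r * g p u v"
  and g_nondeg: "u \<in> T p \<Longrightarrow> (\<And>v. v \<in> T p \<Longrightarrow> g p u v = 0) \<Longrightarrow> u = 0"
  using metric unfolding lorentzian_metric_def sym_bilinear_on_def nondegenerate_on_def by blast+

lemma g_add_right: "u \<in> T p \<Longrightarrow> v \<in> T p \<Longrightarrow> w \<in> T p \<Longrightarrow> g p w (u + v) = g p w u + g p w v"
  using g_add_left g_sym subspace_add[OF subspace_T] by metis

lemma g_scale_right: "u \<in> T p \<Longrightarrow> v \<in> T p \<Longrightarrow> g p v (r *\<^sub>R u) = r * g p v u"
  using g_scale_left g_sym subspace_scale[OF subspace_T] by metis

lemma g_zero_left: "v \<in> T p \<Longrightarrow> g p 0 v = 0"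
  using g_scale_left[OF subspace_0[OF subspace_T], of v p 0] by simp

lemma coordinate_metric:
  assumes c: "c \<in> A" shows "coordinate_metric (cimage c) (metric_coord A g c)"
proof
  show "open (cimage c)" using c by (rule open_cimage)
  show "smooth_on (cimage c) (\<lambda>x. metric_coord A g c x u v)" for u v
    using metric c unfolding lorentzian_metric_def by blast
  fix x u v assume "x \<in> cimage c"
  then obtain p where p: "p \<in> cdom c" "x = cmap c p" by blast
  note cv = coord_vec_in_T[OF c p(1)] and lin = linear_coord_vec[OF c p(1)]
  have eq: "metric_coord A g c x = (\<lambda>u v. g p (coord_vec A c p u) (coord_vec A c p v))"
    by (simp add: metric_coord_def fun_eq_iff p cinv_cmap[OF c])
  show "bilinear (metric_coord A g c x)"
    unfolding eq bilinear_def
    by (intro conjI allI linearI)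
       (simp_all add: linear_add[OF lin] linear_scale[OF lin] cv g_add_left g_add_right
         g_scale_left g_scale_right)
  show "metric_coord A g c x u v = metric_coord A g c x v u"
    unfolding eq by (intro g_sym cv)
  show "u = 0" if "\<And>v. metric_coord A g c x u v = 0"
  proof -
    have "coord_vec A c p u = 0"
    proof (rule g_nondeg[OF cv])
      show "g p (coord_vec A c p u) v = 0" if "v \<in> T p" for v
        using \<open>\<And>v. metric_coord A g c x u v = 0\<close>[of "v c"] coord_vec_coord[OF that c p(1)] by (simp add: eq)
    qed
    then show "u = 0" using coord_vec_self[OF c p(1), of u] by simp
  qed
qed

lemma coordinate_change:
  assumes c: "c \<in> A" and d: "d \<in> A"
  shows "coordinate_change (cimage c) (cimage d) (metric_coord A g c) (metric_coord A g d) (overlap c d) (tr c d)"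
proof -
  interpret C: coordinate_metric "cimage c" "metric_coord A g c" using c by (rule coordinate_metric)
  interpret D: coordinate_metric "cimage d" "metric_coord A g d" using d by (rule coordinate_metric)
  show ?thesis
  proof
    show "open (overlap c d)" using c d by (rule open_overlap)
    show "overlap c d \<subseteq> cimage c" by blast
    show "smooth_on (overlap c d) (tr c d)" using c d by (rule smooth_tr)
    fix x assume "x \<in> overlap c d"
    then obtain p where p: "p \<in> cdom c" "p \<in> cdom d" "x = cmap c p" by blast
    show "tr c d x \<in> cimage d" using p c by (simp add: cinv_cmap)
    show "surj (FD (tr c d) x)"
    proof (rule surjI)
      show "FD (tr c d) x (jac d c p u) = u" for u
        using jac_jac[OF d p(2) c p(1) d p(2)] jac_self[OF d p(2)] by (simp add: p(3))
    qed
    \<comment> \<open>Both sides evaluate \<open>g\<close> at \<open>p\<close> on the same tangent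
      vectors, written in two charts.\<close>
    show "metric_coord A g c x u v = metric_coord A g d (tr c d x) (FD (tr c d) x u) (FD (tr c d) x v)" for u v
    proof -
      have 1: "metric_coord A g c x u v = g p (coord_vec A c p u) (coord_vec A c p v)"
        by (simp add: metric_coord_def p cinv_cmap c)
      have "tr c d x = cmap d p" by (simp add: p cinv_cmap c)
      then have "metric_coord A g d (tr c d x) a b = g p (coord_vec A d p a) (coord_vec A d p b)" for a b
        by (simp add: metric_coord_def p cinv_cmap d)
      then show ?thesis using coord_vec_jac[OF c p(1) d p(2)] 1 by (simp only: p(3))
    qed
  qed
qed

section \<open>Connection and curvature in charts\<close>

abbreviation \<Gamma> where "\<Gamma> c \<equiv> levi_civita (metric_coord A g c)"

lemma christoffel_eq: "christoffel A g c = \<Gamma> c"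
  by (intro ext) (simp add: christoffel_def levi_civita_def koszul_def)

lemma bilinear_christoffel: "c \<in> A \<Longrightarrow> p \<in> cdom c \<Longrightarrow> bilinear (\<Gamma> c (cmap c p))"
  by (rule coordinate_metric.bilinear_levi_civita[OF coordinate_metric]) auto

lemma curvature_eq:
  assumes c: "c \<in> A" "p \<in> cdom c"
  shows "curvature A g p u v w c = riemann (metric_coord A g c) (cmap c p) (u c) (v c) (w c)"
proof -
  have n: "nabla A g c (\<lambda>_. a) (\<lambda>_. b) = (\<lambda>x. \<Gamma> c x a b)" for a b
    by (simp add: nabla_def christoffel_eq)
  have l: "lie_bracket (\<lambda>_. a) (\<lambda>_. b) = (\<lambda>_. 0)" for a b :: 'e
    by (simp add: lie_bracket_def)
  have "\<Gamma> c (cmap c p) 0 b = 0" for b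
    using bilinear_lzero[OF bilinear_christoffel[OF c]] .
  then show ?thesis
    using c by (simp add: curvature_def curvature_coord_def n l riemann_def)
      (simp add: nabla_def christoffel_eq)
qed

lemma curvature_in_T:
  assumes "u \<in> T p" "v \<in> T p" "w \<in> T p" shows "curvature A g p u v w \<in> T p"
proof -
  have "curvature A g p u v w d = jac c d p (curvature A g p u v w c)"
    if c: "c \<in> A" "p \<in> cdom c" and d: "d \<in> A" "p \<in> cdom d" for c d
  proof -
    interpret coordinate_change "cimage c" "cimage d" "metric_coord A g c" "metric_coord A g d"
      "overlap c d" "tr c d" using c(1) d(1) by (rule coordinate_change)
    have x: "cmap c p \<in> overlap c d" using c d by blast
    show ?thesis
      using riemann_transform[OF x, of "u c" "v c" "w c"] tangent_spaceD(1)[OF _ c(1) d(1) c(2) d(2)] assms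
        tr_cmap[OF c, of d]
      by (simp only: curvature_eq[OF c] curvature_eq[OF d])
  qed
  moreover have "curvature A g p u v w c = 0" if "c \<notin> A \<or> p \<notin> cdom c" for c
    using that by (auto simp: curvature_def)
  ultimately show ?thesis unfolding tangent_space_def by blast
qed

lemma curvature_scale:
  "curvature A g p (r *\<^sub>R u) v (r *\<^sub>R w) = (r * r) *\<^sub>R curvature A g p u v w"
proof
  fix c
  show "curvature A g p (r *\<^sub>R u) v (r *\<^sub>R w) c = ((r * r) *\<^sub>R curvature A g p u v w) c"
  proof (cases "c \<in> A \<and> p \<in> cdom c")
    case True
    then interpret C: coordinate_metric "cimage c" "metric_coord A g c"
      using coordinate_metric by blast
    show ?thesis using True C.riemann_scale[of "cmap c p" r "u c" "v c" "w c"]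
      by (simp add: curvature_eq scaleR_fun_def)
  next
    case False
    then show ?thesis by (auto simp: curvature_def scaleR_fun_def)
  qed
qed

section \<open>Fields along a curve\<close>

text \<open>Confined to interior points, where the derivatives within \<open>{0..1}\<close> in
  \<open>velocity\<close> and \<open>cov_deriv\<close> are two-sided and the chain rule
  applies.\<close>

definition regular_at :: "(real \<Rightarrow> 'p) \<Rightarrow> real \<Rightarrow> bool" where
  "regular_at \<sigma> t \<longleftrightarrow> 0 < t \<and> t < 1 \<and> continuous (at t) \<sigma> \<and>
     (\<forall>c\<in>A. \<sigma> t \<in> cdom c \<longrightarrow> (\<lambda>s. cmap c (\<sigma> s)) differentiable (at t))"

text \<open>Tangency is required on a neighbourhood, not just at \<open>t\<close>: comparing
  derivatives in two charts means differentiating the relation between the components.\<close>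

definition differentiable_field_at :: "(real \<Rightarrow> 'p) \<Rightarrow> (real \<Rightarrow> ('p, 'e) tvec) \<Rightarrow> real \<Rightarrow> bool" where
  "differentiable_field_at \<sigma> V t \<longleftrightarrow> (\<forall>\<^sub>F s in nhds t. V s \<in> T (\<sigma> s)) \<and>
     (\<forall>c\<in>A. \<sigma> t \<in> cdom c \<longrightarrow> (\<lambda>s. V s c) differentiable (at t))"

lemma eventually_in_cdom:
  assumes "regular_at \<sigma> t" "c \<in> A" "\<sigma> t \<in> cdom c"
  shows "\<forall>\<^sub>F s in nhds t. \<sigma> s \<in> cdom c"
proof -
  have "(\<sigma> \<longlongrightarrow> \<sigma> t) (at t)" using assms(1) by (simp add: regular_at_def continuous_at)
  then have "\<forall>\<^sub>F s in at t. \<sigma> s \<in> cdom c"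
    using open_cdom[OF assms(2)] assms(3) by (rule topological_tendstoD)
  then show ?thesis using assms(3) by (simp add: eventually_nhds_conv_at)
qed

lemma velocity_deriv:
  assumes "regular_at \<sigma> t" "c \<in> A" "\<sigma> t \<in> cdom c"
  shows "((\<lambda>s. cmap c (\<sigma> s)) has_vector_derivative velocity A \<sigma> t c) (at t)"
  using assms vector_derivative_works[of "\<lambda>s. cmap c (\<sigma> s)" "at t"]
  by (simp add: velocity_def regular_at_def at_within_01)

lemma velocity_in_T:
  assumes reg: "regular_at \<sigma> t" shows "velocity A \<sigma> t \<in> T (\<sigma> t)"
proof -
  have "velocity A \<sigma> t d = jac c d (\<sigma> t) (velocity A \<sigma> t c)"
    if c: "c \<in> A" "\<sigma> t \<in> cdom c" and d: "d \<in> A" "\<sigma> t \<in> cdom d" for c d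
  proof -
    have "((\<lambda>s. tr c d (cmap c (\<sigma> s))) has_derivative (\<lambda>h. h *\<^sub>R jac c d (\<sigma> t) (velocity A \<sigma> t c))) (at t)"
      using has_vector_derivative_compose_linear[OF tr_deriv[OF c(1) d(1) c(2) d(2)] velocity_deriv[OF reg c]]
      by (simp add: has_vector_derivative_def)
    then have "((\<lambda>s. cmap d (\<sigma> s)) has_derivative (\<lambda>h. h *\<^sub>R jac c d (\<sigma> t) (velocity A \<sigma> t c))) (at t)"
      by (rule has_derivative_transform_nhds)
         (use eventually_in_cdom[OF reg c] in \<open>eventually_elim, simp add: cinv_cmap c\<close>)
    then show ?thesis
      using velocity_deriv[OF reg d] vector_derivative_unique_at has_vector_derivative_def by metis
  qed
  moreover have "velocity A \<sigma> t c = 0" if "c \<notin> A \<or> \<sigma> t \<notin> cdom c" for c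
    using that by (auto simp: velocity_def)
  ultimately show ?thesis unfolding tangent_space_def by blast
qed

text \<open>Components change by the Jacobian at the moving point, so the product rule adds a second
  derivative of the coordinate change. This is the term that the Christoffel symbols have to
  compensate.\<close>

lemma field_change_of_chart:
  assumes reg: "regular_at \<sigma> t" and VT: "\<forall>\<^sub>F s in nhds t. V s \<in> T (\<sigma> s)"
    and c: "c \<in> A" "\<sigma> t \<in> cdom c" and d: "d \<in> A" "\<sigma> t \<in> cdom d"
    and V: "((\<lambda>s. V s c) has_vector_derivative V') (at t)"
  shows "((\<lambda>s. V s d) has_vector_derivative
    (FD (\<lambda>y. FD (tr c d) y (V t c)) (cmap c (\<sigma> t)) (velocity A \<sigma> t c) + jac c d (\<sigma> t) V')) (at t)"
proof -
  interpret coordinate_change "cimage c" "cimage d" "metric_coord A g c" "metric_coord A g d"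
    "overlap c d" "tr c d" using c(1) d(1) by (rule coordinate_change)
  have x: "cmap c (\<sigma> t) \<in> overlap c d" using c d by blast
  have "((\<lambda>s. jac c d (\<sigma> s) (V s c)) has_derivative
     (\<lambda>h. h *\<^sub>R D2 (cmap c (\<sigma> t)) (V t c) (velocity A \<sigma> t c) + jac c d (\<sigma> t) (h *\<^sub>R V'))) (at t)"
  proof (rule has_derivative_apply[where L = "\<lambda>s. jac c d (\<sigma> s)" and p = "\<lambda>s. V s c"
        and L' = "\<lambda>a h. h *\<^sub>R D2 (cmap c (\<sigma> t)) a (velocity A \<sigma> t c)"])
    show "\<forall>\<^sub>F s in nhds t. linear (jac c d (\<sigma> s))"
      using eventually_in_cdom[OF reg c] eventually_in_cdom[OF reg d]
      by eventually_elim (intro linear_jac c d)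
    show "((\<lambda>s. V s c) has_derivative (\<lambda>h. h *\<^sub>R V')) (at t)"
      using V by (simp add: has_vector_derivative_def)
    show "((\<lambda>s. jac c d (\<sigma> s) a) has_derivative (\<lambda>h. h *\<^sub>R D2 (cmap c (\<sigma> t)) a (velocity A \<sigma> t c))) (at t)" for a
      using has_vector_derivative_compose_linear[OF D\<phi>_deriv[OF x] velocity_deriv[OF reg c]]
      by (simp add: has_vector_derivative_def)
  qed
  then have "((\<lambda>s. V s d) has_derivative
     (\<lambda>h. h *\<^sub>R D2 (cmap c (\<sigma> t)) (V t c) (velocity A \<sigma> t c) + jac c d (\<sigma> t) (h *\<^sub>R V'))) (at t)"
    by (rule has_derivative_transform_nhds)
       (use VT eventually_in_cdom[OF reg c] eventually_in_cdom[OF reg d] in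
         \<open>eventually_elim, simp add: tangent_spaceD(1)[OF _ c(1) d(1)]\<close>)
  then show ?thesis
    by (simp add: has_vector_derivative_def linear_scale[OF linear_jac[OF c(1) d(1) c(2) d(2)]] scaleR_add_right)
qed

lemma differentiable_field_atI:
  assumes reg: "regular_at \<sigma> t" and VT: "\<forall>\<^sub>F s in nhds t. V s \<in> T (\<sigma> s)"
    and c: "c \<in> A" "\<sigma> t \<in> cdom c" and V: "(\<lambda>s. V s c) differentiable (at t)"
  shows "differentiable_field_at \<sigma> V t"
  unfolding differentiable_field_at_def
proof (intro conjI VT ballI impI)
  fix d assume d: "d \<in> A" "\<sigma> t \<in> cdom d"
  show "(\<lambda>s. V s d) differentiable (at t)"
    using field_change_of_chart[OF reg VT c d V[unfolded vector_derivative_works]]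
    by (rule differentiableI_vector)
qed

lemma cov_deriv_eq:
  assumes reg: "regular_at \<sigma> t" and V: "differentiable_field_at \<sigma> V t" and c: "c \<in> A" "\<sigma> t \<in> cdom c"
  obtains V' where "((\<lambda>s. V s c) has_vector_derivative V') (at t)"
    "cov_deriv A g \<sigma> V t c = V' + \<Gamma> c (cmap c (\<sigma> t)) (velocity A \<sigma> t c) (V t c)"
proof
  show "((\<lambda>s. V s c) has_vector_derivative vector_derivative (\<lambda>s. V s c) (at t)) (at t)"
    using V c vector_derivative_works unfolding differentiable_field_at_def by blast
  show "cov_deriv A g \<sigma> V t c = vector_derivative (\<lambda>s. V s c) (at t)
     + \<Gamma> c (cmap c (\<sigma> t)) (velocity A \<sigma> t c) (V t c)"
    using c reg by (simp add: cov_deriv_def christoffel_eq at_within_01 regular_at_def)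
qed

lemma cov_derivI:
  assumes reg: "regular_at \<sigma> t" and c: "c \<in> A" "\<sigma> t \<in> cdom c"
    and V: "((\<lambda>s. V s c) has_vector_derivative V') (at t)"
  shows "cov_deriv A g \<sigma> V t c = V' + \<Gamma> c (cmap c (\<sigma> t)) (velocity A \<sigma> t c) (V t c)"
  using c reg vector_derivative_at[OF V] by (simp add: cov_deriv_def christoffel_eq at_within_01 regular_at_def)

lemma cov_deriv_outside: "c \<notin> A \<or> \<sigma> t \<notin> cdom c \<Longrightarrow> cov_deriv A g \<sigma> V t c = 0"
  by (auto simp: cov_deriv_def)

text \<open>The second derivative of the coordinate change in the derivative of the components
  cancels the inhomogeneous term in \<open>levi_civita_transform\<close>.\<close>

lemma cov_deriv_in_T:
  assumes reg: "regular_at \<sigma> t" and V: "differentiable_field_at \<sigma> V t"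
  shows "cov_deriv A g \<sigma> V t \<in> T (\<sigma> t)"
proof -
  have VT: "\<forall>\<^sub>F s in nhds t. V s \<in> T (\<sigma> s)" using V by (simp add: differentiable_field_at_def)
  then have Vt: "V t \<in> T (\<sigma> t)" by (rule eventually_nhds_x_imp_x)
  have "cov_deriv A g \<sigma> V t d = jac c d (\<sigma> t) (cov_deriv A g \<sigma> V t c)"
    if c: "c \<in> A" "\<sigma> t \<in> cdom c" and d: "d \<in> A" "\<sigma> t \<in> cdom d" for c d
  proof -
    interpret coordinate_change "cimage c" "cimage d" "metric_coord A g c" "metric_coord A g d"
      "overlap c d" "tr c d" using c(1) d(1) by (rule coordinate_change)
    have x: "cmap c (\<sigma> t) \<in> overlap c d" using c d by blast
    let ?J = "jac c d (\<sigma> t)" and ?v = "velocity A \<sigma> t"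
    obtain V' where V': "((\<lambda>s. V s c) has_vector_derivative V') (at t)"
      and cov: "cov_deriv A g \<sigma> V t c = V' + \<Gamma> c (cmap c (\<sigma> t)) (?v c) (V t c)"
      using cov_deriv_eq[OF reg V c] .
    have "cov_deriv A g \<sigma> V t d = D2 (cmap c (\<sigma> t)) (V t c) (?v c) + ?J V'
       + \<Gamma> d (cmap d (\<sigma> t)) (?v d) (V t d)"
      by (rule cov_derivI[where V = V, OF reg d field_change_of_chart[OF reg VT c d V']])
    also have "?v d = ?J (?v c)" by (rule tangent_spaceD(1)[OF velocity_in_T[OF reg] c(1) d(1) c(2) d(2)])
    also have "V t d = ?J (V t c)" by (rule tangent_spaceD(1)[OF Vt c(1) d(1) c(2) d(2)])
    also have "\<Gamma> d (cmap d (\<sigma> t)) (?J (?v c)) (?J (V t c)) =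
        ?J (\<Gamma> c (cmap c (\<sigma> t)) (?v c) (V t c)) - D2 (cmap c (\<sigma> t)) (V t c) (?v c)"
      using levi_civita_transform[OF x, of "?v c" "V t c"] by (simp only: tr_cmap[OF c]) simp
    finally show ?thesis
      unfolding cov linear_add[OF linear_jac[OF c(1) d(1) c(2) d(2)]] by (simp add: o_def)
  qed
  then show ?thesis using cov_deriv_outside unfolding tangent_space_def by blast
qed

lemma cov_deriv_add:
  assumes reg: "regular_at \<sigma> t" and V: "differentiable_field_at \<sigma> V t" and W: "differentiable_field_at \<sigma> W t"
  shows "cov_deriv A g \<sigma> (V + W) t = cov_deriv A g \<sigma> V t + cov_deriv A g \<sigma> W t"
proof
  fix c
  show "cov_deriv A g \<sigma> (V + W) t c = (cov_deriv A g \<sigma> V t + cov_deriv A g \<sigma> W t) c"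
  proof (cases "c \<in> A \<and> \<sigma> t \<in> cdom c")
    case True
    then have c: "c \<in> A" "\<sigma> t \<in> cdom c" by auto
    obtain V' where V': "((\<lambda>s. V s c) has_vector_derivative V') (at t)"
      "cov_deriv A g \<sigma> V t c = V' + \<Gamma> c (cmap c (\<sigma> t)) (velocity A \<sigma> t c) (V t c)"
      using cov_deriv_eq[OF reg V c] .
    obtain W' where W': "((\<lambda>s. W s c) has_vector_derivative W') (at t)"
      "cov_deriv A g \<sigma> W t c = W' + \<Gamma> c (cmap c (\<sigma> t)) (velocity A \<sigma> t c) (W t c)"
      using cov_deriv_eq[OF reg W c] .
    have "((\<lambda>s. (V + W) s c) has_vector_derivative V' + W') (at t)"
      using has_vector_derivative_add[OF V'(1) W'(1)] by simp
    then show ?thesis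
      by (simp add: cov_derivI[OF reg c] V'(2) W'(2) bilinear_radd[OF bilinear_christoffel[OF c]])
  qed (use cov_deriv_outside in simp)
qed

lemma cov_deriv_scale:
  assumes reg: "regular_at \<sigma> t" and V: "differentiable_field_at \<sigma> V t"
  shows "cov_deriv A g \<sigma> (r *\<^sub>R V) t = r *\<^sub>R cov_deriv A g \<sigma> V t"
proof
  fix c
  show "cov_deriv A g \<sigma> (r *\<^sub>R V) t c = (r *\<^sub>R cov_deriv A g \<sigma> V t) c"
  proof (cases "c \<in> A \<and> \<sigma> t \<in> cdom c")
    case True
    then have c: "c \<in> A" "\<sigma> t \<in> cdom c" by auto
    obtain V' where V': "((\<lambda>s. V s c) has_vector_derivative V') (at t)"
      "cov_deriv A g \<sigma> V t c = V' + \<Gamma> c (cmap c (\<sigma> t)) (velocity A \<sigma> t c) (V t c)"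
      using cov_deriv_eq[OF reg V c] .
    have "((\<lambda>s. (r *\<^sub>R V) s c) has_vector_derivative r *\<^sub>R V') (at t)"
      using bounded_linear.has_vector_derivative[OF bounded_linear_scaleR_right V'(1)]
      by (simp add: scaleR_fun_def)
    then show ?thesis
      by (simp add: cov_derivI[OF reg c] V'(2) bilinear_rmul[OF bilinear_christoffel[OF c]]
          scaleR_fun_def scaleR_add_right)
  qed (use cov_deriv_outside in \<open>simp add: scaleR_fun_def\<close>)
qed

lemma cov_deriv_eventually_zero:
  assumes reg: "regular_at \<sigma> t" and V: "\<forall>\<^sub>F s in nhds t. V s = 0"
  shows "cov_deriv A g \<sigma> V t = 0"
proof
  fix c
  have V0: "V t = 0" using V by (rule eventually_nhds_x_imp_x)
  show "cov_deriv A g \<sigma> V t c = 0 c"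
  proof (cases "c \<in> A \<and> \<sigma> t \<in> cdom c")
    case True
    then have c: "c \<in> A" "\<sigma> t \<in> cdom c" by auto
    have "((\<lambda>s. V s c) has_derivative (\<lambda>h. 0)) (at t)"
      by (rule has_derivative_transform_nhds[OF has_derivative_const[of 0]])
         (use V in \<open>eventually_elim, simp\<close>)
    then have "((\<lambda>s. V s c) has_vector_derivative 0) (at t)" by (simp add: has_vector_derivative_def)
    from cov_derivI[where V = V, OF reg c this] show ?thesis
      by (simp add: V0 bilinear_rzero[OF bilinear_christoffel[OF c]])
  qed (use cov_deriv_outside in simp)
qed

section \<open>Linear reparametrization of a curve\<close>

context
  fixes \<sigma> \<tau> :: "real \<Rightarrow> 'p" and r s :: real
  assumes \<tau>: "\<And>s. \<tau> s = \<sigma> (r * s)" and reg: "regular_at \<sigma> (r * s)" and s: "0 < s" "s < 1"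
begin

lemma regular_at_rescale: "regular_at \<tau> s"
proof -
  have "continuous (at s) (\<lambda>s. \<sigma> (r * s))"
    using continuous_at_compose[of s "\<lambda>s. r * s" \<sigma>] reg by (simp add: regular_at_def o_def)
  moreover have "(\<lambda>s. cmap c (\<sigma> (r * s))) differentiable (at s)" if "c \<in> A" "\<sigma> (r * s) \<in> cdom c" for c
    using has_vector_derivative_rescale[OF velocity_deriv[OF reg that]] by (rule differentiableI_vector)
  moreover have "\<tau> = (\<lambda>s. \<sigma> (r * s))" by (rule ext) (rule \<tau>)
  ultimately show ?thesis using s by (simp add: regular_at_def)
qed

lemma velocity_rescale: "velocity A \<tau> s = r *\<^sub>R velocity A \<sigma> (r * s)"
proof
  fix c
  show "velocity A \<tau> s c = (r *\<^sub>R velocity A \<sigma> (r * s)) c"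
  proof (cases "c \<in> A \<and> \<tau> s \<in> cdom c")
    case True
    then have c: "c \<in> A" "\<tau> s \<in> cdom c" "\<sigma> (r * s) \<in> cdom c" by (auto simp: \<tau>)
    have "((\<lambda>s. cmap c (\<tau> s)) has_vector_derivative r *\<^sub>R velocity A \<sigma> (r * s) c) (at s)"
      unfolding \<tau> using has_vector_derivative_rescale[OF velocity_deriv[OF reg c(1,3)]] .
    then show ?thesis
      using velocity_deriv[OF regular_at_rescale c(1,2)] vector_derivative_unique_at
      by (simp add: scaleR_fun_def) blast
  qed (auto simp: velocity_def \<tau> scaleR_fun_def)
qed

context
  fixes V :: "real \<Rightarrow> ('p, 'e) tvec"
  assumes V: "differentiable_field_at \<sigma> V (r * s)"
begin

lemma cov_deriv_rescale: "cov_deriv A g \<tau> (\<lambda>s. V (r * s)) s = r *\<^sub>R cov_deriv A g \<sigma> V (r * s)"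
proof
  fix c
  show "cov_deriv A g \<tau> (\<lambda>s. V (r * s)) s c = (r *\<^sub>R cov_deriv A g \<sigma> V (r * s)) c"
  proof (cases "c \<in> A \<and> \<tau> s \<in> cdom c")
    case True
    then have c: "c \<in> A" "\<tau> s \<in> cdom c" "\<sigma> (r * s) \<in> cdom c" by (auto simp: \<tau>)
    obtain V' where V': "((\<lambda>s. V s c) has_vector_derivative V') (at (r * s))"
      "cov_deriv A g \<sigma> V (r * s) c = V' + \<Gamma> c (cmap c (\<sigma> (r * s))) (velocity A \<sigma> (r * s) c) (V (r * s) c)"
      using cov_deriv_eq[OF reg V c(1,3)] .
    show ?thesis
      unfolding cov_derivI[where V = "\<lambda>s. V (r * s)", OF regular_at_rescale c(1,2) has_vector_derivative_rescale[OF V'(1)]]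
      by (simp add: velocity_rescale V'(2) scaleR_fun_def scaleR_add_right \<tau>
          bilinear_lmul[OF bilinear_christoffel[OF c(1,3)]])
  qed (auto simp: cov_deriv_def \<tau> scaleR_fun_def)
qed

end

end

lemma differentiable_field_at_vector_field:
  assumes Y: "smooth_vector_field A Y" and reg: "regular_at \<sigma> t"
  shows "differentiable_field_at \<sigma> (\<lambda>s. Y (\<sigma> s)) t"
proof -
  obtain c where c: "c \<in> A" "\<sigma> t \<in> cdom c" by (rule chart_around)
  have "smooth_on (cimage c) (\<lambda>x. Y (cinv c x) c)" using Y c by (simp add: smooth_vector_field_def)
  then have "((\<lambda>x. Y (cinv c x) c) has_derivative FD (\<lambda>x. Y (cinv c x) c) (cmap c (\<sigma> t))) (at (cmap c (\<sigma> t)))"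
    using c by (intro smooth_on_imp_has_derivative) auto
  from has_vector_derivative_compose_linear[OF this velocity_deriv[OF reg c]]
  have "((\<lambda>s. Y (cinv c (cmap c (\<sigma> s))) c) has_derivative
     (\<lambda>h. h *\<^sub>R FD (\<lambda>x. Y (cinv c x) c) (cmap c (\<sigma> t)) (velocity A \<sigma> t c))) (at t)"
    by (simp add: has_vector_derivative_def)
  then have "((\<lambda>s. Y (\<sigma> s) c) has_derivative
     (\<lambda>h. h *\<^sub>R FD (\<lambda>x. Y (cinv c x) c) (cmap c (\<sigma> t)) (velocity A \<sigma> t c))) (at t)"
    by (rule has_derivative_transform_nhds)
       (use eventually_in_cdom[OF reg c] in \<open>eventually_elim, simp add: cinv_cmap c\<close>)
  then have "(\<lambda>s. Y (\<sigma> s) c) differentiable (at t)" by (auto simp: differentiable_def)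
  moreover have "\<forall>\<^sub>F s in nhds t. Y (\<sigma> s) \<in> T (\<sigma> s)"
    using Y by (simp add: smooth_vector_field_def)
  ultimately show ?thesis using differentiable_field_atI[where V = "\<lambda>s. Y (\<sigma> s)", OF reg _ c] by simp
qed

end

subsection \<open>Index forms of iterates\<close>

locale lorentzian_curve = lorentzian A g
  for A :: "('p::{t2_space, second_countable_topology}, 'e::euclidean_space) chart set"
    and g :: "('p, 'e) metric" +
  fixes Y :: "'p \<Rightarrow> ('p, 'e) tvec" and \<gamma> :: "real \<Rightarrow> 'p"
  assumes Y: "smooth_vector_field A Y"
    and \<gamma>_cont: "continuous_on {0..1} \<gamma>"
    and \<gamma>_diff: "t \<in> {0..1} \<Longrightarrow> c \<in> A \<Longrightarrow> \<gamma> t \<in> cdom c \<Longrightarrow>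
      (\<lambda>s. cmap c (\<gamma> s)) differentiable (at t within {0..1})"
begin

text \<open>Away from integer values of \<open>N * t\<close> the integer part is locally constant,
  so the iterate is locally \<gamma> composed with an affine map into the open unit
  interval.\<close>

lemma regular_at_iterate:
  assumes t: "0 < t" "t < 1" and int: "real N * t \<notin> \<int>"
  shows "regular_at (iterate \<gamma> N) t"
proof -
  define k where "k = \<lfloor>real N * t\<rfloor>"
  have "of_int k \<noteq> real N * t" using int Ints_of_int by metis
  moreover have "of_int k \<le> real N * t \<and> real N * t < of_int k + 1"
    unfolding k_def by linarith
  ultimately have k: "of_int k < real N * t" "real N * t < of_int k + 1" by linarith+
  have ev: "\<forall>\<^sub>F s in nhds t. \<gamma> (real N * s - of_int k) = iterate \<gamma> N s"
  proof -
    have "open {s. of_int k < real N * s \<and> real N * s < of_int k + 1}"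
      by (intro open_Collect_conj open_Collect_less continuous_intros)
    from eventually_nhds_in_open[OF this] have
      "\<forall>\<^sub>F s in nhds t. s \<in> {s. of_int k < real N * s \<and> real N * s < of_int k + 1}" using k by simp
    then show ?thesis
    proof eventually_elim
      case (elim s)
      then have "\<lfloor>real N * s\<rfloor> = k" by (intro floor_unique) auto
      then show ?case by (simp add: iterate_def frac_def)
    qed
  qed
  let ?\<theta> = "\<lambda>s. real N * s - of_int k"
  have \<theta>: "0 < ?\<theta> t" "?\<theta> t < 1" using k by auto
  have \<gamma>t: "iterate \<gamma> N t = \<gamma> (?\<theta> t)" by (rule eventually_nhds_x_imp_x[OF ev, symmetric])
  have "continuous (at (?\<theta> t)) \<gamma>"
    using continuous_on_interior[OF \<gamma>_cont] \<theta> by simp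
  moreover have \<theta>c: "continuous (at t) ?\<theta>" by (intro continuous_intros)
  ultimately have "continuous (at t) (\<lambda>s. \<gamma> (?\<theta> s))"
    using continuous_at_compose[OF \<theta>c] by (simp add: o_def)
  then have "(\<lambda>s. \<gamma> (?\<theta> s)) \<midarrow>t\<rightarrow> \<gamma> (?\<theta> t)" by (simp add: continuous_at)
  then have "iterate \<gamma> N \<midarrow>t\<rightarrow> iterate \<gamma> N t"
    unfolding \<gamma>t by (rule Lim_transform_eventually)
      (use ev in \<open>simp add: eventually_nhds_conv_at\<close>)
  then have cont: "continuous (at t) (iterate \<gamma> N)" by (simp add: continuous_at)
  have "(\<lambda>s. cmap c (iterate \<gamma> N s)) differentiable (at t)" if c: "c \<in> A" "iterate \<gamma> N t \<in> cdom c" for c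
  proof -
    have "(\<lambda>s. cmap c (\<gamma> s)) differentiable (at (?\<theta> t) within {0..1})"
      using \<gamma>_diff[of "?\<theta> t" c] \<theta> c by (simp add: \<gamma>t)
    then have "((\<lambda>s. cmap c (\<gamma> s)) has_derivative FD (\<lambda>s. cmap c (\<gamma> s)) (?\<theta> t)) (at (?\<theta> t))"
      unfolding at_within_01[OF \<theta>] by (rule frechet_derivative_works[THEN iffD1])
    moreover have "(?\<theta> has_derivative (\<lambda>h. real N * h)) (at t)"
      by (auto intro!: derivative_eq_intros)
    ultimately have "((\<lambda>s. cmap c (\<gamma> (?\<theta> s))) has_derivative
        (\<lambda>h. FD (\<lambda>s. cmap c (\<gamma> s)) (?\<theta> t) (real N * h))) (at t)"
      using has_derivative_compose by blast
    then have "((\<lambda>s. cmap c (iterate \<gamma> N s)) has_derivative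
        (\<lambda>h. FD (\<lambda>s. cmap c (\<gamma> s)) (?\<theta> t) (real N * h))) (at t)"
      by (rule has_derivative_transform_nhds) (use ev in \<open>eventually_elim, simp\<close>)
    then show ?thesis by (rule differentiableI)
  qed
  then show ?thesis using t cont by (simp add: regular_at_def)
qed

lemma negligible_irregular:
  assumes "N \<ge> 1" shows "negligible {t\<in>{0..1}. \<not> regular_at (iterate \<gamma> N) t}"
proof (rule negligible_subset)
  have "{t. real N * t \<in> \<int>} \<subseteq> (\<lambda>z. z / real N) ` \<int>"
    using assms by (force simp: image_iff field_simps)
  then have "countable {t. real N * t \<in> \<int>}"
    by (rule countable_subset) (simp add: countable_int)
  then have "negligible {t. real N * t \<in> \<int>}"
    unfolding negligible_iff_null_sets by (intro null_sets_completionI countable_imp_null_set_lborel)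
  then show "negligible ({t. real N * t \<in> \<int>} \<union> {0, 1})"
    by (rule negligible_Un) (simp add: negligible_finite)
  show "{t\<in>{0..1}. \<not> regular_at (iterate \<gamma> N) t} \<subseteq> {t. real N * t \<in> \<int>} \<union> {0, 1}"
  proof
    fix t assume "t \<in> {t\<in>{0..1}. \<not> regular_at (iterate \<gamma> N) t}"
    then have "t = 0 \<or> t = 1 \<or> 0 < t \<and> t < 1" "\<not> regular_at (iterate \<gamma> N) t" by auto
    then show "t \<in> {t. real N * t \<in> \<int>} \<union> {0, 1}" using regular_at_iterate[of t N] by blast
  qed
qed

definition good :: "(real \<Rightarrow> 'p) \<Rightarrow> (real \<Rightarrow> ('p, 'e) tvec) \<Rightarrow> real \<Rightarrow> bool" where
  "good \<sigma> V t \<longleftrightarrow> regular_at \<sigma> t \<and> differentiable_field_at \<sigma> V t"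

text \<open>The H1 condition is available only on intervals that the curve maps into one chart.
  Every regular point lies inside such an interval with rational end points. Fixing one chart per
  rational interval keeps the exceptional set a countable union of null sets, however large the
  atlas is; one chart suffices by \<open>differentiable_field_atI\<close>.\<close>

lemma negligible_not_good:
  assumes reg: "negligible {t\<in>{0..1}. \<not> regular_at \<sigma> t}" and V: "H1_field_along A \<sigma> V"
  shows "negligible {t\<in>{0..1}. \<not> good \<sigma> V t}"
proof -
  define I where "I = {(a, b). a \<in> \<rat> \<and> b \<in> \<rat> \<and> 0 \<le> a \<and> a < b \<and> b \<le> (1::real) \<and> (\<exists>c\<in>A. \<sigma> ` {a..b} \<subseteq> cdom c)}"
  define ch where "ch = (\<lambda>(a, b). SOME c. c \<in> A \<and> \<sigma> ` {a..b} \<subseteq> cdom c)"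
  have ch: "ch (a, b) \<in> A \<and> \<sigma> ` {a..b} \<subseteq> cdom (ch (a, b))" if "(a, b) \<in> I" for a b
  proof -
    have "\<exists>c. c \<in> A \<and> \<sigma> ` {a..b} \<subseteq> cdom c" using that unfolding I_def by blast
    from someI_ex[OF this] show ?thesis by (simp add: ch_def)
  qed
  define Bad where "Bad = (\<lambda>(a, b). {t\<in>{a<..<b}. \<not> (\<lambda>s. V s (ch (a, b))) differentiable (at t)})"
  have "countable I"
    by (rule countable_subset[of _ "\<rat> \<times> \<rat>"]) (auto simp: I_def intro!: countable_SIGMA countable_rat)
  have "negligible (Bad i)" if "i \<in> I" for i
  proof (cases i)
    case (Pair a b)
    then have ab: "(a, b) \<in> I" using that by simp
    then have "H1_on a b (\<lambda>t. V t (ch (a, b)))"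
      using V ch[OF ab] unfolding H1_field_along_def by (auto simp: I_def)
    from H1_on_differentiable[OF this] show ?thesis by (simp add: Bad_def Pair)
  qed
  then have "negligible (\<Union>i\<in>I. Bad i)"
    using \<open>countable I\<close> by (intro negligible_countable_Union) auto
  moreover have "{t\<in>{0..1}. \<not> good \<sigma> V t} \<subseteq> {t\<in>{0..1}. \<not> regular_at \<sigma> t} \<union> (\<Union>i\<in>I. Bad i)"
  proof
    fix t assume t: "t \<in> {t\<in>{0..1}. \<not> good \<sigma> V t}"
    show "t \<in> {t\<in>{0..1}. \<not> regular_at \<sigma> t} \<union> (\<Union>i\<in>I. Bad i)"
    proof (rule ccontr)
      assume "t \<notin> {t\<in>{0..1}. \<not> regular_at \<sigma> t} \<union> (\<Union>i\<in>I. Bad i)"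
      then have r: "regular_at \<sigma> t" and nb: "\<And>i. i \<in> I \<Longrightarrow> t \<notin> Bad i" using t by auto
      then have t01: "0 < t" "t < 1" by (auto simp: regular_at_def)
      obtain c where c: "c \<in> A" "\<sigma> t \<in> cdom c" by (rule chart_around)
      obtain \<epsilon> where \<epsilon>: "\<epsilon> > 0" "\<And>s. dist s t < \<epsilon> \<Longrightarrow> \<sigma> s \<in> cdom c"
        using eventually_in_cdom[OF r c] unfolding eventually_nhds_metric by blast
      obtain a where a: "a \<in> \<rat>" "max 0 (t - \<epsilon>) < a" "a < t"
        using Rats_dense_in_real[of "max 0 (t - \<epsilon>)" t] t01 \<epsilon> by auto
      obtain b where b: "b \<in> \<rat>" "t < b" "b < min 1 (t + \<epsilon>)"
        using Rats_dense_in_real[of t "min 1 (t + \<epsilon>)"] t01 \<epsilon> by auto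
      have "\<sigma> ` {a..b} \<subseteq> cdom c" using a b by (auto intro!: \<epsilon>(2) simp: dist_real_def)
      then have ab: "(a, b) \<in> I" using a b c by (auto simp: I_def)
      have "(\<lambda>s. V s (ch (a, b))) differentiable (at t)"
        using nb[OF ab] a b by (auto simp: Bad_def)
      moreover have "\<forall>\<^sub>F s in nhds t. V s \<in> T (\<sigma> s)"
        by (rule eventually_mono[OF eventually_nhds_in_open[of "{0<..<1}"]])
           (use t01 V in \<open>auto simp: H1_field_along_def\<close>)
      moreover have "\<sigma> t \<in> cdom (ch (a, b))" using ch[OF ab] a b by auto
      ultimately have "differentiable_field_at \<sigma> V t"
        using ch[OF ab] by (intro differentiable_field_atI[OF r]) auto
      then show False using t r by (simp add: good_def)
    qed
  qed
  ultimately show ?thesis using negligible_subset negligible_Un reg by blast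
qed

definition constraint :: "(real \<Rightarrow> 'p) \<Rightarrow> (real \<Rightarrow> ('p, 'e) tvec) \<Rightarrow> real \<Rightarrow> real" where
  "constraint \<sigma> V t = g (\<sigma> t) (cov_deriv A g \<sigma> V t) (Y (\<sigma> t))
     - g (\<sigma> t) (V t) (cov_deriv A g \<sigma> (\<lambda>s. Y (\<sigma> s)) t)"

definition integrand :: "(real \<Rightarrow> 'p) \<Rightarrow> (real \<Rightarrow> ('p, 'e) tvec) \<Rightarrow> real \<Rightarrow> real" where
  "integrand \<sigma> V t = g (\<sigma> t) (cov_deriv A g \<sigma> V t) (cov_deriv A g \<sigma> V t)
     + g (\<sigma> t) (curvature A g (\<sigma> t) (velocity A \<sigma> t) (V t) (velocity A \<sigma> t)) (V t)"

lemma index_form_eq: "index_form A g \<sigma> V V = integral {0..1} (integrand \<sigma> V)"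
  unfolding index_form_def integrand_def ..

lemma mem_tangent_N:
  "V \<in> tangent_N A g Y \<sigma> \<longleftrightarrow> H1_field_along A \<sigma> V \<and> V 0 = V 1 \<and>
     (\<exists>k. negligible {t\<in>{0..1}. constraint \<sigma> V t \<noteq> k})"
  unfolding tangent_N_def constraint_def AE_lebesgue_on_01 by simp

lemma Y_in_T: "Y p \<in> T p" using Y by (simp add: smooth_vector_field_def)

lemma goodD:
  assumes "good \<sigma> V t"
  shows "regular_at \<sigma> t" "differentiable_field_at \<sigma> V t" "V t \<in> T (\<sigma> t)"
    "cov_deriv A g \<sigma> V t \<in> T (\<sigma> t)"
  using assms cov_deriv_in_T eventually_nhds_x_imp_x
  unfolding good_def differentiable_field_at_def by blast+

lemma cov_Y_in_T: "regular_at \<sigma> t \<Longrightarrow> cov_deriv A g \<sigma> (\<lambda>s. Y (\<sigma> s)) t \<in> T (\<sigma> t)"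
  by (intro cov_deriv_in_T differentiable_field_at_vector_field Y)

lemma constraint_add:
  assumes V: "good \<sigma> V t" and W: "good \<sigma> W t"
  shows "constraint \<sigma> (V + W) t = constraint \<sigma> V t + constraint \<sigma> W t"
  using goodD[OF V] goodD[OF W] cov_Y_in_T[of \<sigma> t]
  by (simp add: constraint_def cov_deriv_add g_add_left Y_in_T)

lemma constraint_scale:
  assumes V: "good \<sigma> V t"
  shows "constraint \<sigma> (r *\<^sub>R V) t = r * constraint \<sigma> V t"
proof -
  have "(r *\<^sub>R V) t = r *\<^sub>R V t" by (simp add: scaleR_fun_def)
  then show ?thesis using goodD[OF V] cov_Y_in_T[of \<sigma> t]
    by (simp add: constraint_def cov_deriv_scale g_scale_left Y_in_T right_diff_distrib)
qed

lemma constraint_rescale: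
  assumes \<tau>: "\<And>s. \<tau> s = \<sigma> (r * s)" and s: "0 < s" "s < 1" and V: "good \<sigma> V (r * s)"
  shows "constraint \<tau> (\<lambda>s. V (r * s)) s = r * constraint \<sigma> V (r * s)"
proof -
  note r = goodD(1)[OF V]
  have Y': "cov_deriv A g \<tau> (\<lambda>s. Y (\<tau> s)) s = r *\<^sub>R cov_deriv A g \<sigma> (\<lambda>s. Y (\<sigma> s)) (r * s)"
    using cov_deriv_rescale[where \<tau> = \<tau> and \<sigma> = \<sigma> and r = r, OF \<tau> r s
        differentiable_field_at_vector_field[OF Y r]] by (simp only: \<tau>)
  show ?thesis
    unfolding constraint_def Y' cov_deriv_rescale[OF \<tau> r s goodD(2)[OF V]] unfolding \<tau>
    using goodD[OF V] cov_Y_in_T[OF r]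
    by (simp add: g_scale_left g_scale_right Y_in_T right_diff_distrib)
qed

text \<open>Both terms are quadratic in derivatives along the curve: two covariant derivatives in
  the first, two velocities in the curvature term.\<close>

lemma integrand_rescale:
  assumes \<tau>: "\<And>s. \<tau> s = \<sigma> (r * s)" and s: "0 < s" "s < 1" and V: "good \<sigma> V (r * s)"
  shows "integrand \<tau> (\<lambda>s. V (r * s)) s = r * r * integrand \<sigma> V (r * s)"
proof -
  note r = goodD(1)[OF V]
  have v: "velocity A \<sigma> (r * s) \<in> T (\<sigma> (r * s))" using r by (rule velocity_in_T)
  show ?thesis
    unfolding integrand_def cov_deriv_rescale[OF \<tau> r s goodD(2)[OF V]] velocity_rescale[OF \<tau> r s]
      curvature_scale unfolding \<tau>
    using goodD[OF V] curvature_in_T[OF v goodD(3)[OF V] v]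
    by (simp add: g_scale_left g_scale_right subspace_scale[OF subspace_T] distrib_left)
qed

lemma vanishing_field:
  assumes r: "regular_at \<tau> s" and V: "\<forall>\<^sub>F s in nhds s. V s = 0"
  shows "constraint \<tau> V s = 0" "integrand \<tau> V s = 0"
proof -
  have 0: "V s = 0" using V by (rule eventually_nhds_x_imp_x)
  have c: "curvature A g (\<tau> s) (velocity A \<tau> s) 0 (velocity A \<tau> s) \<in> T (\<tau> s)"
    by (intro curvature_in_T velocity_in_T r subspace_0[OF subspace_T])
  show "constraint \<tau> V s = 0"
    by (simp add: constraint_def 0 cov_deriv_eventually_zero[OF r V] g_zero_left Y_in_T cov_Y_in_T[OF r])
  show "integrand \<tau> V s = 0"
    using g_sym[OF c subspace_0[OF subspace_T]] g_zero_left[OF c]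
    by (simp add: integrand_def 0 cov_deriv_eventually_zero[OF r V] g_zero_left subspace_0[OF subspace_T])
qed

section \<open>The rescaled field\<close>

context
  fixes \<sigma> \<tau> :: "real \<Rightarrow> 'p" and \<rho> :: real and V :: "real \<Rightarrow> ('p, 'e) tvec"
  assumes \<rho>: "\<rho> > 1" and \<tau>: "\<And>s. \<tau> s = \<sigma> (\<rho> * s)"
    and reg: "negligible {t\<in>{0..1}. \<not> regular_at \<sigma> t}" "negligible {t\<in>{0..1}. \<not> regular_at \<tau> t}"
    and H1: "H1_field_along A \<sigma> V" and V01: "V 0 = 0" "V 1 = 0"
    and con: "negligible {t\<in>{0..1}. constraint \<sigma> V t \<noteq> 0}"
begin

text \<open>The normalization outside \<open>{0..1}\<close> already performs the extension by zero,
  so the plain composition \<open>\<lambda>s. V (\<rho> * s)\<close> is the field wanted on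
  \<open>{0..1}\<close>.\<close>

lemma V_outside: "t \<le> 0 \<or> 1 \<le> t \<Longrightarrow> V t = 0"
  using H1 V01 unfolding H1_field_along_def by (metis atLeastAtMost_iff order_antisym)

text \<open>Off one null set every parameter is of one of two kinds: it corresponds to a good point
  of \<open>V\<close>, or the rescaled field vanishes around it. The junction 1 / \<rho> is put into
  \<open>Z\<close> because no neighbourhood of it is of a single kind.\<close>

lemma rescaled_cases:
  defines "Z \<equiv> {s. \<rho> * s \<in> {t\<in>{0..1}. \<not> good \<sigma> V t}} \<union> {s\<in>{0..1}. \<not> regular_at \<tau> s} \<union> {0, 1, 1 / \<rho>}"
  shows "negligible Z"
    and "\<And>s. s \<in> {0..1} - Z \<Longrightarrow> s < 1 / \<rho> \<Longrightarrow> 0 < s \<and> s < 1 \<and> good \<sigma> V (\<rho> * s)"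
    and "\<And>s. s \<in> {0..1} - Z \<Longrightarrow> \<not> s < 1 / \<rho> \<Longrightarrow> regular_at \<tau> s \<and> (\<forall>\<^sub>F s in nhds s. V (\<rho> * s) = 0)"
proof -
  show "negligible Z" unfolding Z_def
    using \<rho> by (intro negligible_Un negligible_preimage_scale negligible_not_good reg H1)
      (auto simp: negligible_finite)
  show "0 < s \<and> s < 1 \<and> good \<sigma> V (\<rho> * s)" if s: "s \<in> {0..1} - Z" "s < 1 / \<rho>" for s
  proof -
    have "\<rho> * s < 1" using s(2) \<rho> by (simp add: field_simps)
    moreover have "0 \<le> \<rho> * s" using s(1) \<rho> by simp
    ultimately have "good \<sigma> V (\<rho> * s)" using s(1) by (auto simp: Z_def)
    then show ?thesis using s(1) by (auto simp: Z_def)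
  qed
  show "regular_at \<tau> s \<and> (\<forall>\<^sub>F s in nhds s. V (\<rho> * s) = 0)" if s: "s \<in> {0..1} - Z" "\<not> s < 1 / \<rho>" for s
  proof
    show "regular_at \<tau> s" using s by (auto simp: Z_def)
    have "s \<in> {1 / \<rho><..}" using s by (auto simp: Z_def)
    from eventually_nhds_in_open[OF _ this]
    have "\<forall>\<^sub>F s in nhds s. s \<in> {1 / \<rho><..}" by simp
    then show "\<forall>\<^sub>F s in nhds s. V (\<rho> * s) = 0"
    proof eventually_elim
      case (elim s)
      then have "1 \<le> \<rho> * s" using \<rho> by (simp add: field_simps)
      then show ?case by (simp add: V_outside)
    qed
  qed
qed

lemma constraint_rescaled: "negligible {s\<in>{0..1}. constraint \<tau> (\<lambda>s. V (\<rho> * s)) s \<noteq> 0}"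
proof -
  let ?Z = "{s. \<rho> * s \<in> {t\<in>{0..1}. \<not> good \<sigma> V t}} \<union> {s\<in>{0..1}. \<not> regular_at \<tau> s} \<union> {0, 1, 1 / \<rho>}"
  let ?C = "{s. \<rho> * s \<in> {t\<in>{0..1}. constraint \<sigma> V t \<noteq> 0}}"
  have "negligible (?Z \<union> ?C)"
    using rescaled_cases(1) negligible_preimage_scale[OF con, of \<rho>] \<rho> by (intro negligible_Un) auto
  moreover have "constraint \<tau> (\<lambda>s. V (\<rho> * s)) s = 0" if s: "s \<in> {0..1} - ?Z" "s \<notin> ?C" for s
  proof (cases "s < 1 / \<rho>")
    case True
    then have "\<rho> * s \<in> {0..1}" using s(1) \<rho> by (auto simp: field_simps)
    then have "constraint \<sigma> V (\<rho> * s) = 0" using s(2) by auto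
    then show ?thesis using constraint_rescale[where \<tau> = \<tau> and \<sigma> = \<sigma> and r = \<rho>, OF \<tau>] rescaled_cases(2)[OF s(1) True] by simp
  next
    case False
    from rescaled_cases(3)[OF s(1) this] show ?thesis by (intro vanishing_field(1)) auto
  qed
  ultimately show ?thesis by (elim negligible_subset) blast
qed

lemma H1_rescaled: "H1_field_along A \<tau> (\<lambda>s. V (\<rho> * s))"
  unfolding H1_field_along_def
proof (intro conjI ballI allI impI)
  show "V (\<rho> * s) \<in> T (\<tau> s)" if "s \<in> {0..1}" for s
  proof (cases "\<rho> * s \<in> {0..1}")
    case True
    then show ?thesis using H1 by (simp add: H1_field_along_def \<tau>)
  next
    case False
    then have "V (\<rho> * s) = 0" by (intro V_outside) auto
    then show ?thesis by (simp add: subspace_0[OF subspace_T])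
  qed
  show "V (\<rho> * s) = 0" if "s \<notin> {0..1}" for s
  proof (rule V_outside)
    show "\<rho> * s \<le> 0 \<or> 1 \<le> \<rho> * s"
    proof (cases "s < 0")
      case True
      then show ?thesis using \<rho> mult_pos_neg[of \<rho> s] by auto
    next
      case False
      then have "1 < s" using that by auto
      then have "1 * 1 \<le> \<rho> * s" using \<rho> by (intro mult_mono) auto
      then show ?thesis by simp
    qed
  qed
  fix c a b assume c: "c \<in> A" and ab: "0 \<le> a \<and> a \<le> b \<and> b \<le> 1 \<and> \<tau> ` {a..b} \<subseteq> cdom c"
  have \<rho>0: "\<rho> > 0" using \<rho> by linarith
  then have rab: "\<rho> * a \<le> \<rho> * b" "0 \<le> \<rho> * a" using ab by (auto intro: mult_left_mono)
  \<comment> \<open>The bound \<open>m \<le> 1\<close> is essential, as the hypothesis on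
    \<open>V\<close> covers only subintervals of \<open>{0..1}\<close>.\<close>
  have sub: "H1_on (\<rho> * a) m (\<lambda>t. V t c)" if m: "\<rho> * a \<le> m" "m \<le> \<rho> * b" "m \<le> 1" for m
  proof -
    have "\<sigma> ` {\<rho> * a..m} \<subseteq> cdom c"
    proof
      fix p assume "p \<in> \<sigma> ` {\<rho> * a..m}"
      then obtain t where t: "t \<in> {\<rho> * a..m}" "p = \<sigma> t" by blast
      have "t / \<rho> \<in> {a..b}" using t(1) m(2) \<rho>0 by (auto simp: pos_le_divide_eq pos_divide_le_eq mult.commute)
      moreover have "p = \<tau> (t / \<rho>)" using \<rho>0 by (simp add: \<tau> t(2))
      ultimately show "p \<in> cdom c" using ab by blast
    qed
    then show ?thesis using H1 c m rab unfolding H1_field_along_def by blast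
  qed
  \<comment> \<open>The interval may lie beyond 1, lie below 1, or straddle 1; in the last case
    \<open>V\<close> is extended by zero from 1 on.\<close>
  have "H1_on (\<rho> * a) (\<rho> * b) (\<lambda>t. V t c)"
  proof (cases "\<rho> * a \<ge> 1")
    case True
    then show ?thesis using rab by (intro H1_on_zero) (auto simp: V_outside)
  next
    case False
    show ?thesis
    proof (cases "\<rho> * b \<le> 1")
      case True
      then show ?thesis using sub rab by simp
    next
      case b: False
      show ?thesis
        by (rule H1_on_extend_zero[OF sub[of 1]]) (use False b in \<open>auto simp: V_outside\<close>)
    qed
  qed
  then show "H1_on a b (\<lambda>s. V (\<rho> * s) c)" using \<rho>0 by (rule H1_on_rescale)
qed

lemma rescaled_in_tangent_N: "(\<lambda>s. V (\<rho> * s)) \<in> tangent_N A g Y \<tau>"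
  unfolding mem_tangent_N using H1_rescaled constraint_rescaled V_outside[of 0] V_outside[of \<rho>] \<rho>
  by (auto intro!: exI[of _ 0])

text \<open>The integrand gains \<rho> * \<rho>, the substitution on \<open>{0..1 / \<rho>}\<close>
  gives 1 / \<rho>, and the rest of the interval contributes 0.\<close>

lemma index_form_rescaled:
  assumes "index_form A g \<sigma> V V < 0"
  shows "index_form A g \<tau> (\<lambda>s. V (\<rho> * s)) (\<lambda>s. V (\<rho> * s)) = \<rho> * index_form A g \<sigma> V V"
proof -
  let ?I = "index_form A g \<sigma> V V"
  let ?Z = "{s. \<rho> * s \<in> {t\<in>{0..1}. \<not> good \<sigma> V t}} \<union> {s\<in>{0..1}. \<not> regular_at \<tau> s} \<union> {0, 1, 1 / \<rho>}"
  have \<rho>0: "\<rho> > 0" using \<rho> by linarith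
  \<comment> \<open>A nonintegrable function would have integral 0, so negativity of the index form
    supplies integrability.\<close>
  have "integrand \<sigma> V integrable_on {0..1}"
    using assms not_integrable_integral[of "integrand \<sigma> V" "{0..1}"] by (auto simp: index_form_eq)
  then have "(integrand \<sigma> V has_integral ?I) {\<rho> * 0..\<rho> * (1 / \<rho>)}"
    using \<rho>0 by (simp add: index_form_eq integrable_integral)
  from has_integral_mult_right[OF has_integral_stretch_real[OF this, of \<rho>], of "\<rho> * \<rho>"]
  have 1: "((\<lambda>s. \<rho> * \<rho> * integrand \<sigma> V (\<rho> * s)) has_integral \<rho> * ?I) {0..1 / \<rho>}"
    unfolding image_divide_interval[OF \<rho>0] using \<rho>0 by simp
  have "(integrand \<tau> (\<lambda>s. V (\<rho> * s)) has_integral \<rho> * ?I) {0..1 / \<rho>}"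
  proof (rule has_integral_spike[OF rescaled_cases(1) _ 1])
    show "integrand \<tau> (\<lambda>s. V (\<rho> * s)) s = \<rho> * \<rho> * integrand \<sigma> V (\<rho> * s)" if s: "s \<in> {0..1 / \<rho>} - ?Z" for s
    proof -
      have "1 / \<rho> < 1" using \<rho> by simp
      then have "s \<in> {0..1} - ?Z" "s < 1 / \<rho>" using s by auto
      from rescaled_cases(2)[OF this] show ?thesis
        by (intro integrand_rescale[where \<tau> = \<tau> and \<sigma> = \<sigma> and r = \<rho>, OF \<tau>]) auto
    qed
  qed
  moreover have "(integrand \<tau> (\<lambda>s. V (\<rho> * s)) has_integral 0) {1 / \<rho>..1}"
  proof (rule has_integral_spike[OF rescaled_cases(1) _ has_integral_0])
    show "integrand \<tau> (\<lambda>s. V (\<rho> * s)) s = 0" if s: "s \<in> {1 / \<rho>..1} - ?Z" for s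
    proof -
      have "0 < 1 / \<rho>" using \<rho>0 by simp
      then have "0 \<le> s" using s by (meson DiffD1 atLeastAtMost_iff less_imp_le order_trans)
      then have "s \<in> {0..1} - ?Z" "\<not> s < 1 / \<rho>" using s by auto
      from rescaled_cases(3)[OF this] show ?thesis by (intro vanishing_field(2)) auto
    qed
  qed
  ultimately have "(integrand \<tau> (\<lambda>s. V (\<rho> * s)) has_integral (\<rho> * ?I + 0)) {0..1}"
    using \<rho> by (intro has_integral_combine[of 0 "1 / \<rho>" 1]) auto
  then show ?thesis by (simp add: index_form_eq integral_unique)
qed

end

lemma zero_in_tangent_N:
  assumes reg: "negligible {t\<in>{0..1}. \<not> regular_at \<sigma> t}"
  shows "0 \<in> tangent_N A g Y \<sigma>"
  unfolding mem_tangent_N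
proof (intro conjI exI)
  show "H1_field_along A \<sigma> 0"
    unfolding H1_field_along_def by (auto simp: subspace_0[OF subspace_T] intro!: H1_on_zero)
  have "constraint \<sigma> 0 t = 0" if "regular_at \<sigma> t" for t
    using that by (rule vanishing_field(1)) simp
  then show "negligible {t\<in>{0..1}. constraint \<sigma> 0 t \<noteq> 0}"
    by (intro negligible_subset[OF reg]) blast
qed simp

section \<open>The constant of a tangent field as a linear functional\<close>

text \<open>On \<open>tangent_N\<close> the value is unique, because \<open>{0..1}\<close> is not
  negligible; that uniqueness also gives additivity and homogeneity there.\<close>

definition constraint_value :: "(real \<Rightarrow> 'p) \<Rightarrow> (real \<Rightarrow> ('p, 'e) tvec) \<Rightarrow> real" where
  "constraint_value \<sigma> V = (SOME k. negligible {t\<in>{0..1}. constraint \<sigma> V t \<noteq> k})"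

lemma constraint_value:
  "V \<in> tangent_N A g Y \<sigma> \<Longrightarrow> negligible {t\<in>{0..1}. constraint \<sigma> V t \<noteq> constraint_value \<sigma> V}"
  unfolding mem_tangent_N constraint_value_def by (elim conjE) (rule someI_ex)

lemma constraint_value_eqI:
  assumes "V \<in> tangent_N A g Y \<sigma>" "negligible {t\<in>{0..1}. constraint \<sigma> V t \<noteq> k}"
  shows "constraint_value \<sigma> V = k"
  by (rule almost_everywhere_value_unique[OF constraint_value[OF assms(1)] assms(2)])

context
  fixes \<sigma> :: "real \<Rightarrow> 'p"
  assumes reg: "negligible {t\<in>{0..1}. \<not> regular_at \<sigma> t}"
begin

lemma negligible_not_good_tangent_N:
  "V \<in> tangent_N A g Y \<sigma> \<Longrightarrow> negligible {t\<in>{0..1}. \<not> good \<sigma> V t}"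
  using negligible_not_good[OF reg] by (simp add: mem_tangent_N)

lemma constraint_value_add:
  assumes V: "V \<in> tangent_N A g Y \<sigma>" and W: "W \<in> tangent_N A g Y \<sigma>" and VW: "V + W \<in> tangent_N A g Y \<sigma>"
  shows "constraint_value \<sigma> (V + W) = constraint_value \<sigma> V + constraint_value \<sigma> W"
proof (rule constraint_value_eqI[OF VW], rule negligible_subset)
  show "negligible ({t\<in>{0..1}. \<not> good \<sigma> V t} \<union> {t\<in>{0..1}. \<not> good \<sigma> W t}
     \<union> {t\<in>{0..1}. constraint \<sigma> V t \<noteq> constraint_value \<sigma> V}
     \<union> {t\<in>{0..1}. constraint \<sigma> W t \<noteq> constraint_value \<sigma> W})"
    by (intro negligible_Un negligible_not_good_tangent_N constraint_value V W)
  show "{t\<in>{0..1}. constraint \<sigma> (V + W) t \<noteq> constraint_value \<sigma> V + constraint_value \<sigma> W} \<subseteq>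
    {t\<in>{0..1}. \<not> good \<sigma> V t} \<union> {t\<in>{0..1}. \<not> good \<sigma> W t}
     \<union> {t\<in>{0..1}. constraint \<sigma> V t \<noteq> constraint_value \<sigma> V}
     \<union> {t\<in>{0..1}. constraint \<sigma> W t \<noteq> constraint_value \<sigma> W}"
    using constraint_add by auto
qed

lemma constraint_value_scale:
  assumes V: "V \<in> tangent_N A g Y \<sigma>" and rV: "r *\<^sub>R V \<in> tangent_N A g Y \<sigma>"
  shows "constraint_value \<sigma> (r *\<^sub>R V) = r * constraint_value \<sigma> V"
proof (rule constraint_value_eqI[OF rV], rule negligible_subset)
  show "negligible ({t\<in>{0..1}. \<not> good \<sigma> V t} \<union> {t\<in>{0..1}. constraint \<sigma> V t \<noteq> constraint_value \<sigma> V})"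
    by (intro negligible_Un negligible_not_good_tangent_N constraint_value V)
  show "{t\<in>{0..1}. constraint \<sigma> (r *\<^sub>R V) t \<noteq> r * constraint_value \<sigma> V} \<subseteq>
    {t\<in>{0..1}. \<not> good \<sigma> V t} \<union> {t\<in>{0..1}. constraint \<sigma> V t \<noteq> constraint_value \<sigma> V}"
    using constraint_scale by auto
qed

end

section \<open>Comparison of negative subspaces\<close>

text \<open>The set whose supremum is the Morse index. Comparing its elements rather than the
  suprema avoids any appeal to boundedness.\<close>

definition negative_dims :: "(real \<Rightarrow> 'p) \<Rightarrow> nat set" where
  "negative_dims \<sigma> = {dim S | S. subspace S \<and> S \<subseteq> tangent_N A g Y \<sigma> \<and>
     (\<forall>v\<in>S. v \<noteq> 0 \<longrightarrow> index_form A g \<sigma> v v < 0)}"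

lemma zero_in_negative_dims:
  assumes "negligible {t\<in>{0..1}. \<not> regular_at \<sigma> t}"
  shows "0 \<in> negative_dims \<sigma>"
  unfolding negative_dims_def
  using zero_in_tangent_N[OF assms] dim_span_eq_card_independent[OF independent_empty]
  by (intro CollectI exI[of _ "{0}"]) auto

lemma negative_dims_rescale:
  assumes \<rho>: "\<rho> > 1" and \<tau>: "\<And>s. \<tau> s = \<sigma> (\<rho> * s)"
    and reg: "negligible {t\<in>{0..1}. \<not> regular_at \<sigma> t}" "negligible {t\<in>{0..1}. \<not> regular_at \<tau> t}"
    and n: "n \<in> negative_dims \<sigma>"
  shows "\<exists>m\<in>negative_dims \<tau>. n \<le> m + (DIM('e) + 1)"
\<comment> \<open>An infinite basis has cardinality 0, so \<open>n \<noteq> 0\<close> guarantees a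
  finite basis of \<open>S\<close>. For \<open>n = 0\<close> the zero subspace along \<tau> is
  enough.\<close>
proof (cases "n = 0")
  case True
  then show ?thesis using zero_in_negative_dims[OF reg(2)] by (intro bexI[of _ 0]) auto
next
  case False
  obtain S where Sn: "n = dim S" and S: "subspace S" "S \<subseteq> tangent_N A g Y \<sigma>"
    and neg: "\<forall>v\<in>S. v \<noteq> 0 \<longrightarrow> index_form A g \<sigma> v v < 0"
    using n unfolding negative_dims_def by (elim CollectE exE conjE)
  obtain B where B: "B \<subseteq> S" "independent B" "S \<subseteq> span B" "card B = dim S"
    by (rule basis_exists)
  have finB: "finite B" using False B(4) Sn by (metis card.infinite)
  have spB: "span B = S" using B(1,3) S(1) by (intro subset_antisym span_minimal)
  obtain c where c: "c \<in> A" "\<sigma> 0 \<in> cdom c" by (rule chart_around)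
  \<comment> \<open>A tangent vector is determined by its component in a single chart, so the kernel
    of \<Lambda> consists of the fields with \<open>V 0 = 0\<close> and vanishing constant. Its
    target has dimension \<open>DIM('e) + 1\<close>, the constant in the claim.\<close>
  define \<Lambda> where "\<Lambda> = (\<lambda>V :: real \<Rightarrow> ('p, 'e) tvec. (V 0 c, constraint_value \<sigma> V))"
  have add: "\<Lambda> (u + v) = \<Lambda> u + \<Lambda> v" if "u \<in> S" "v \<in> S" for u v
    using constraint_value_add[OF reg(1), of u v] that S(2) subspace_add[OF S(1) that]
    by (auto simp: \<Lambda>_def)
  have scale: "\<Lambda> (r *\<^sub>R v) = r *\<^sub>R \<Lambda> v" if "v \<in> S" for r v
    using constraint_value_scale[OF reg(1), of v r] that S(2) subspace_scale[OF S(1) that, of r]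
    by (auto simp: \<Lambda>_def scaleR_fun_def)
  obtain B0 where B0: "finite B0" "independent B0" "span B0 = {v\<in>S. \<Lambda> v = 0}"
    "card B \<le> card B0 + DIM('e \<times> real)"
    by (rule kernel_basis_card_on[where \<Lambda> = \<Lambda>, OF S(1) finB B(2) spB add scale])
  define R where "R = (\<lambda>V :: real \<Rightarrow> ('p, 'e) tvec. \<lambda>s. V (\<rho> * s))"
  have linR: "linear R" by (rule linearI) (auto simp: R_def scaleR_fun_def)
  have injR: "inj R"
  proof (rule injI)
    fix V W assume "R V = R W"
    then have "V (\<rho> * (t / \<rho>)) = W (\<rho> * (t / \<rho>))" for t unfolding R_def by (rule fun_cong)
    then show "V = W" using \<rho> by auto
  qed
  have ker: "R V \<in> tangent_N A g Y \<tau> \<and> (R V \<noteq> 0 \<longrightarrow> index_form A g \<tau> (R V) (R V) < 0)"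
    if V: "V \<in> span B0" for V
  proof -
    have VS: "V \<in> S" "V 0 c = 0" "constraint_value \<sigma> V = 0"
      using V B0(3) by (auto simp: \<Lambda>_def zero_prod_def)
    then have VN: "V \<in> tangent_N A g Y \<sigma>" using S(2) by blast
    then have H1: "H1_field_along A \<sigma> V" and V01: "V 0 = V 1" by (auto simp: mem_tangent_N)
    have "V 0 \<in> T (\<sigma> 0)" using H1 by (simp add: H1_field_along_def)
    from coord_vec_coord[OF this c] have V0: "V 0 = 0"
      using linear_0[OF linear_coord_vec[OF c]] VS(2) by simp
    have con: "negligible {t\<in>{0..1}. constraint \<sigma> V t \<noteq> 0}"
      using constraint_value[OF VN] VS(3) by simp
    note hyps = \<rho> \<tau> reg H1 V0 trans[OF V01[symmetric] V0] con
    have "index_form A g \<tau> (R V) (R V) < 0" if "R V \<noteq> 0"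
    proof -
      have "V \<noteq> 0" using that linear_0[OF linR] by auto
      then have I: "index_form A g \<sigma> V V < 0" using neg VS(1) by simp
      have "index_form A g \<tau> (R V) (R V) = \<rho> * index_form A g \<sigma> V V"
        unfolding R_def using index_form_rescaled[OF hyps I] .
      then show ?thesis using I \<rho> by (simp add: mult_pos_neg)
    qed
    then show ?thesis using rescaled_in_tangent_N[OF hyps] by (auto simp: R_def)
  qed
  have indR: "independent (R ` B0)"
    by (rule linear_independent_injective_image[OF linR B0(2) inj_on_subset[OF injR]]) simp
  have "dim (R ` span B0) = card B0"
    using dim_span_eq_card_independent[OF indR] card_image[OF inj_on_subset[OF injR], of B0]
    by (simp add: linear_span_image[OF linR])
  moreover have "subspace (R ` span B0)" using linR by (rule linear_subspace_image) (rule subspace_span)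
  ultimately have "card B0 \<in> negative_dims \<tau>"
    unfolding negative_dims_def using ker by (intro CollectI exI[of _ "R ` span B0"]) auto
  moreover have "n \<le> card B0 + (DIM('e) + 1)" using B0(4) B(4) Sn by simp
  ultimately show ?thesis by blast
qed

lemma morse_index_iterate:
  "\<exists>d :: nat \<Rightarrow> int. (\<exists>K. \<forall>N\<ge>1. \<bar>d N\<bar> \<le> K) \<and>
    mono_on {1..} (\<lambda>N. int (morse_index A g Y (iterate \<gamma> N)) + d N)"
proof -
  have eq: "morse_index A g Y (iterate \<gamma> N) = Sup (negative_dims (iterate \<gamma> N))" for N
    by (simp add: morse_index_def neg_index_def negative_dims_def)
  show ?thesis unfolding eq
  proof (rule nondecreasing_correction)
    show "negative_dims (iterate \<gamma> N) \<noteq> {}" if "1 \<le> N" for N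
      using zero_in_negative_dims[OF negligible_irregular[OF that]] by blast
    fix N M n :: nat assume NM: "1 \<le> N" "N \<le> M" and n: "n \<in> negative_dims (iterate \<gamma> N)"
    show "\<exists>m\<in>negative_dims (iterate \<gamma> M). n \<le> m + (DIM('e) + 1)"
    \<comment> \<open>Rescaling requires a ratio strictly above 1; for equal iterates there is
      nothing to compare.\<close>
    proof (cases "N = M")
      case True
      then show ?thesis using n by (intro bexI[of _ n]) auto
    next
      case False
      show ?thesis
      proof (rule negative_dims_rescale[OF _ _ _ _ n])
        show "real M / real N > 1" using NM False by simp
        show "iterate \<gamma> M s = iterate \<gamma> N (real M / real N * s)" for s
          using NM by (simp add: iterate_def)
      qed (rule negligible_irregular, use NM in simp)+
    qed
  qed
qed

end

theorem lemma6p5: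
  fixes A :: "('p::{t2_space, second_countable_topology}, 'e::euclidean_space) chart set"
    and g :: "('p, 'e) metric"
    and Y :: "'p \<Rightarrow> ('p, 'e) tvec"
    and \<gamma> :: "real \<Rightarrow> 'p"
  assumes "smooth_atlas A"
    and "lorentzian_metric A g"
    and "killing_field A g Y"
    and "timelike_field g Y"
    and "closed_geodesic A g \<gamma>"
  shows "\<exists>d :: nat \<Rightarrow> int. (\<exists>K. \<forall>N\<ge>1. \<bar>d N\<bar> \<le> K) \<and>
    mono_on {1..} (\<lambda>N. int (morse_index A g Y (iterate \<gamma> N)) + d N)"
proof -
  interpret lorentzian_curve A g Y \<gamma>
    using assms
    by unfold_locales (auto simp: killing_field_def closed_geodesic_def geodesic_def)
  show ?thesis by (rule morse_index_iterate)
qed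

end
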